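(* For any constants $A$ and $C$ there is a constant $B$ such that the following holds for all sufficiently large $n$ (depending on $A$ and $C$). Let $M$ be an $n\times n$ matrix with integer entries, all of absolute value at most $n^C$, and let $N_n$ be the $n\times n$ random Bernoulli matrix. Then $$\mathbf{P}\big(\|(M+N_n)^{-1}\|\ge n^B\big)\le n^{-A}.$$
   Context: The $n\times n$ random Bernoulli matrix is the random matrix whose entries are i.i.d. random variables taking the values $-1$ and $1$ with probability $1/2$ each. $\|\cdot\|$ denotes the operator norm (largest singular value) $\|M\|=\sup_{x\in\mathbb{R}^n,\|x\|=1}\|Mx\|$ with respect to the Euclidean norm. Convention: if a matrix $T$ is singular, $\|T^{-1}\|=\infty$. *)

theory Defs
  imports
    "HOL-Probability.Probability"
    "Jordan_Normal_Form.Gauss_Jordan_Elimination"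
    "Jordan_Normal_Form.Determinant"
begin

definition eucl_norm :: "real vec \<Rightarrow> real" where
  "eucl_norm v = sqrt (scalar_prod v v)"

(* Valued in ennreal, so that the supremum needs no boundedness argument and the norm of the
   inverse of a singular matrix can be infinite. *)
definition op_norm :: "real mat \<Rightarrow> ennreal" where
  "op_norm A = (SUP x \<in> {x \<in> carrier_vec (dim_col A). eucl_norm x = 1}. ennreal (eucl_norm (A *\<^sub>v x)))"

definition inverse_op_norm :: "real mat \<Rightarrow> ennreal" where
  "inverse_op_norm A = (case mat_inverse A of None \<Rightarrow> \<infinity> | Some B \<Rightarrow> op_norm B)"

(* The default value 0 is taken only outside the index set, so it is never an entry. *)
definition bernoulli_matrix :: "nat \<Rightarrow> real mat pmf" where
  "bernoulli_matrix n =
     map_pmf (mat n n) (Pi_pmf ({..<n} \<times> {..<n}) 0 (\<lambda>_. pmf_of_set {-1, 1}))"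

lemma inverse_op_norm_inverts:
  assumes "A \<in> carrier_mat n n" "B \<in> carrier_mat n n" "A * B = 1\<^sub>m n" "B * A = 1\<^sub>m n"
  shows "inverse_op_norm A = op_norm B"
proof -
  have "A \<in> Units (ring_mat TYPE(real) n ())"
    using assms unfolding Units_def ring_mat_def by auto
  then obtain B' where B': "mat_inverse A = Some B'"
    using mat_inverse(1)[OF assms(1), of "()"] by (cases "mat_inverse A") auto
  have 1: "A * B' = 1\<^sub>m n" "B' \<in> carrier_mat n n"
    using mat_inverse(2)[OF assms(1) B'] by auto
  have "B = B * (A * B')" unfolding 1(1) using right_mult_one_mat[OF assms(2)] by (rule sym)
  also have "\<dots> = B * A * B'" by (rule assoc_mult_mat[OF assms(2,1) 1(2), symmetric])
  also have "\<dots> = B'" unfolding assms(4) by (rule left_mult_one_mat[OF 1(2)])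
  finally show ?thesis using B' by (simp add: inverse_op_norm_def)
qed

lemma inverse_op_norm_singular:
  assumes "A \<in> carrier_mat n n" "det A = 0"
  shows "inverse_op_norm A = \<infinity>"
proof (cases "mat_inverse A")
  case (Some B)
  have "det A * det B = 1"
    using mat_inverse(2)[OF assms(1) Some] det_mult[OF assms(1), of B] by simp
  then show ?thesis using assms(2) by simp
qed (simp add: inverse_op_norm_def)

end

theory Submission
  imports Defs "HOL-Real_Asymp.Real_Asymp"
begin

text \<open>If \<open>\<parallel>(M + N)\<inverse>\<parallel>\<close> is large then, for some column \<open>i\<close>, every vector orthogonal to the other
  columns is almost orthogonal to column \<open>i\<close>. Take such a vector depending on the other columns only,
  scale it by a large power \<open>T\<close> of \<open>n\<close> and round it to an integer vector \<open>W\<close>. If no short interval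
  carries much of the law of the random walk \<open>S = \<Sum> \<xi>\<^sub>k W\<^sub>k\<close>, conditioning on the other columns bounds
  the probability of the event. The remaining, rich, vectors \<open>W\<close> are handled by a union bound that
  replaces the inverse Littlewood-Offord theorem.

  For a set \<open>I\<close> of coordinates and a scale \<open>h\<close> let \<open>Q\<^sub>I(u)\<close> be the autocorrelation of the law of
  \<open>\<Sum>\<^bsub>k\<in>I\<^esub> \<xi>\<^sub>k W\<^sub>k\<close> smoothed at scale \<open>h\<close>. Adding the coordinate \<open>k\<close> to \<open>I\<close> turns \<open>Q\<^sub>I(0)\<close> into
  \<open>(Q\<^sub>I(0) + Q\<^sub>I(2W\<^sub>k)) / 2\<close>, so a greedy choice finds a set \<open>I\<close> of size \<open>O(m\<^sup>2 log n)\<close> such that all other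
  \<open>2W\<^sub>k\<close> lie in the level set \<open>Q\<^sub>I(u) \<ge> (1 - 1/(2m\<^sup>2)) Q\<^sub>I(0)\<close>. Since \<open>sqrt (Q\<^sub>I(0) - Q\<^sub>I(u))\<close> is
  subadditive, \<open>m\<close>-fold sums of elements of this level set stay in \<open>{Q\<^sub>I \<ge> Q\<^sub>I(0)/2}\<close>, and therefore
  the level set has an \<open>h\<close>-net of size at most \<open>1 + 2/(m Q\<^sub>I(0))\<close>. On the other hand, by
  Cauchy-Schwarz, splitting the coordinates into two halves, one column is almost orthogonal to \<open>W\<close>
  with probability at most \<open>2 sqrt (Q(0) Q'(0))\<close>, with the autocorrelations of the two halves. So the
  factor \<open>m\<close> beats the size of the net in the \<open>n\<close>-th power. Rounding \<open>W\<close> to the net costs a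
  polynomial factor in the scale; by pigeonhole over boundedly many scales this changes \<open>Q Q'\<close> only
  by a factor \<open>n\<^bsup>1/8\<^esup>\<close>, which \<open>m \<approx> n\<^bsup>1/4\<^esup>\<close> absorbs.\<close>

section \<open>Finitely supported functions on the integers\<close>

definition finsupp :: "(int \<Rightarrow> real) \<Rightarrow> bool" where
  "finsupp f \<longleftrightarrow> finite {t. f t \<noteq> 0}"

text \<open>The sum runs over the support of the left argument only, so the right one may have
  infinite support, as the constant 1 has in the computation of the total mass. The price is that
  symmetry needs both supports finite.\<close>

definition ip :: "(int \<Rightarrow> real) \<Rightarrow> (int \<Rightarrow> real) \<Rightarrow> real" where
  "ip f g = (\<Sum>t | f t \<noteq> 0. f t * g t)"

lemma ip_eq_sum:
  assumes "finite F" "\<And>t. f t \<noteq> 0 \<Longrightarrow> t \<in> F"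
  shows "ip f g = (\<Sum>t\<in>F. f t * g t)"
  unfolding ip_def by (rule sum.mono_neutral_left) (use assms in auto)

lemma ip_shift: "ip (\<lambda>t. f (t + u)) (\<lambda>t. g (t + u)) = ip f g"
  unfolding ip_def
  by (rule sum.reindex_bij_witness[where i = "\<lambda>t. t - u" and j = "\<lambda>t. t + u"]) auto

lemma finsupp_shift: "finsupp f \<Longrightarrow> finsupp (\<lambda>t. f (t + u))"
proof -
  assume "finsupp f"
  moreover have "{t. f (t + u) \<noteq> 0} = (\<lambda>t. t - u) ` {t. f t \<noteq> 0}"
    by (force simp: image_iff intro: exI[of _ "_ + u"])
  ultimately show ?thesis by (simp add: finsupp_def)
qed

lemma finsupp_shift_diff: "finsupp f \<Longrightarrow> finsupp (\<lambda>t. f (t - u))"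
  using finsupp_shift[of f "- u"] by simp

lemma finsupp_comb:
  assumes "finsupp f" "finsupp g"
  shows "finsupp (\<lambda>t. a * f t + b * g t)"
  unfolding finsupp_def
  by (rule finite_subset[of _ "{t. f t \<noteq> 0} \<union> {t. g t \<noteq> 0}"]) (use assms in \<open>auto simp: finsupp_def\<close>)

lemma ip_eq_support2:
  assumes "finsupp f" "finsupp g"
  shows "ip f g = (\<Sum>t\<in>{t. f t \<noteq> 0} \<union> {t. g t \<noteq> 0}. f t * g t)"
  by (rule ip_eq_sum) (use assms in \<open>auto simp: finsupp_def\<close>)

lemma ip_commute:
  assumes "finsupp f" "finsupp g"
  shows "ip f g = ip g f"
  unfolding ip_eq_support2[OF assms] ip_eq_support2[OF assms(2,1)]
  by (simp add: Un_commute mult.commute)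

lemma ip_comb_left:
  assumes "finsupp f" "finsupp g"
  shows "ip (\<lambda>t. a * f t + b * g t) k = a * ip f k + b * ip g k"
proof -
  let ?F = "{t. f t \<noteq> 0} \<union> {t. g t \<noteq> 0}"
  have "finite ?F" using assms by (auto simp: finsupp_def)
  then have "ip (\<lambda>t. a * f t + b * g t) k = (\<Sum>t\<in>?F. (a * f t + b * g t) * k t)"
    "ip f k = (\<Sum>t\<in>?F. f t * k t)" "ip g k = (\<Sum>t\<in>?F. g t * k t)"
    by (auto intro!: ip_eq_sum)
  then show ?thesis by (simp add: sum.distrib sum_distrib_left algebra_simps)
qed

lemma ip_comb_right: "ip k (\<lambda>t. a * f t + b * g t) = a * ip k f + b * ip k g"
  by (simp add: ip_def sum.distrib sum_distrib_left algebra_simps)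

lemma ip_self_nonneg: "0 \<le> ip f f"
  unfolding ip_def by (simp add: sum_nonneg)

lemma ip_Cauchy_Schwarz:
  assumes "finsupp f" "finsupp g"
  shows "ip f g \<le> sqrt (ip f f * ip g g)"
proof -
  let ?F = "{t. f t \<noteq> 0} \<union> {t. g t \<noteq> 0}"
  have fin: "finite ?F" using assms by (auto simp: finsupp_def)
  have 1: "ip f g = (\<Sum>t\<in>?F. f t * g t)" "ip f f = (\<Sum>t\<in>?F. (f t)\<^sup>2)" "ip g g = (\<Sum>t\<in>?F. (g t)\<^sup>2)"
    using fin by (auto intro!: ip_eq_sum simp: power2_eq_square)
  have "(\<Sum>t\<in>?F. f t * g t) \<le> (\<Sum>t\<in>?F. \<bar>f t\<bar> * \<bar>g t\<bar>)"
    by (intro sum_mono) (simp add: abs_mult[symmetric])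
  also have "\<dots> \<le> L2_set f ?F * L2_set g ?F"
    by (rule L2_set_mult_ineq)
  finally show ?thesis unfolding 1 L2_set_def real_sqrt_mult .
qed

lemma ip_triangle:
  assumes "finsupp f" "finsupp g"
  shows "sqrt (ip (\<lambda>t. f t + g t) (\<lambda>t. f t + g t)) \<le> sqrt (ip f f) + sqrt (ip g g)"
proof -
  let ?F = "{t. f t \<noteq> 0} \<union> {t. g t \<noteq> 0}"
  have fin: "finite ?F" using assms by (auto simp: finsupp_def)
  have 1: "ip (\<lambda>t. f t + g t) (\<lambda>t. f t + g t) = (\<Sum>t\<in>?F. (f t + g t)\<^sup>2)"
    "ip f f = (\<Sum>t\<in>?F. (f t)\<^sup>2)" "ip g g = (\<Sum>t\<in>?F. (g t)\<^sup>2)"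
    using fin by (auto intro!: ip_eq_sum simp: power2_eq_square)
  show ?thesis
    unfolding 1 using L2_set_triangle_ineq[of f g ?F] by (simp add: L2_set_def)
qed

section \<open>Autocorrelation of the smoothed random walk\<close>

text \<open>\<open>avg W I f t\<close> is the expectation of \<open>f (t - \<Sum> \<xi>\<^sub>i W\<^sub>i)\<close> over independent signs \<open>\<xi>\<^sub>i\<close>, \<open>i \<in> I\<close>.\<close>

definition avg :: "('i \<Rightarrow> int) \<Rightarrow> 'i set \<Rightarrow> (int \<Rightarrow> real) \<Rightarrow> int \<Rightarrow> real" where
  "avg W I f = Finite_Set.fold (\<lambda>i f t. (f (t - W i) + f (t + W i)) / 2) f I"

text \<open>Translations commute, so the fold defining \<open>avg\<close> does not depend on the
  order of the coordinates.\<close>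

lemma comp_fun_commute_avg:
  "comp_fun_commute (\<lambda>i f t. (f (t - W i) + f (t + W i)) / (2::real) :: real)" for W :: "'i \<Rightarrow> int"
  by unfold_locales (auto simp: fun_eq_iff field_simps)

lemma avg_empty [simp]: "avg W {} f = f"
  by (simp add: avg_def)

lemma avg_insert [simp]:
  assumes "finite I" "i \<notin> I"
  shows "avg W (insert i I) f t = (avg W I f (t - W i) + avg W I f (t + W i)) / 2"
proof -
  interpret comp_fun_commute "\<lambda>i f t. (f (t - W i) + f (t + W i)) / (2::real)"
    by (rule comp_fun_commute_avg)
  show ?thesis unfolding avg_def fold_insert[OF assms] ..
qed

lemma avg_cong:
  assumes "finite I" "\<And>i. i \<in> I \<Longrightarrow> W i = W' i"
  shows "avg W I f = avg W' I f"
  using assms by (induction I rule: finite_induct) (auto simp: fun_eq_iff)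

lemma avg_mono:
  assumes "finite I" "\<And>t. f t \<le> g t"
  shows "avg W I f t \<le> avg W I g t"
  using assms(1)
proof (induction I arbitrary: t rule: finite_induct)
  case (insert i I)
  show ?case using insert.IH[of "t - W i"] insert.IH[of "t + W i"] insert.hyps by simp
qed (use assms in auto)

lemma avg_const: "finite I \<Longrightarrow> avg W I (\<lambda>_. c) t = c"
  by (induction I arbitrary: t rule: finite_induct) auto

lemma avg_add: "finite I \<Longrightarrow> avg W I (\<lambda>t. f t + g t) t = avg W I f t + avg W I g t"
  by (induction I arbitrary: t rule: finite_induct) (auto simp: field_simps)

lemma avg_scale: "finite I \<Longrightarrow> avg W I (\<lambda>t. c * f t) t = c * avg W I f t"
  by (induction I arbitrary: t rule: finite_induct) (auto simp: field_simps)

lemma avg_shift: "finite I \<Longrightarrow> avg W I (\<lambda>t. f (t + u)) t = avg W I f (t + u)"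
  by (induction I arbitrary: t rule: finite_induct) (auto simp: algebra_simps)

lemma finsupp_avg: "finite I \<Longrightarrow> finsupp f \<Longrightarrow> finsupp (avg W I f)"
proof (induction I rule: finite_induct)
  case (insert i I)
  have "avg W (insert i I) f = (\<lambda>t. (1/2) * avg W I f (t - W i) + (1/2) * avg W I f (t + W i))"
    using insert by (auto simp: fun_eq_iff field_simps)
  then show ?case
    using finsupp_comb[OF finsupp_shift_diff finsupp_shift, of "avg W I f" "avg W I f" "1/2" "W i" "1/2" "W i"] insert
    by simp
qed auto

lemma avg_reindex_fst:
  assumes "finite I"
  shows "avg (\<lambda>x. W (fst x)) (I \<times> {j}) f = avg W I f"
  using assms
proof (induction I rule: finite_induct)
  case (insert i I)
  have "insert i I \<times> {j} = insert (i, j) (I \<times> {j})" by auto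
  then show ?case using insert by (auto simp: fun_eq_iff)
qed auto

section \<open>Smoothing at scale \<open>h\<close> and the autocorrelation\<close>

definition ibox :: "int \<Rightarrow> int \<Rightarrow> real" where
  "ibox h t = of_bool (0 \<le> t \<and> t < h)"

definition iball :: "int \<Rightarrow> int \<Rightarrow> real" where
  "iball r t = of_bool (\<bar>t\<bar> \<le> r)"

text \<open>Dividing by \<open>h\<close>, the squared norm of the box, gives the empty walk
  autocorrelation 1 at 0.\<close>

definition corr :: "int \<Rightarrow> ('i \<Rightarrow> int) \<Rightarrow> 'i set \<Rightarrow> int \<Rightarrow> real" where
  "corr h W I u = ip (avg W I (ibox h)) (\<lambda>t. avg W I (ibox h) (t + u)) / real_of_int h"

lemma finsupp_ibox: "finsupp (ibox h)"
proof -
  have "{t. ibox h t \<noteq> 0} = {0..<h}" by (auto simp: ibox_def)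
  then show ?thesis by (simp add: finsupp_def)
qed

lemma ip_ibox: "ip (ibox h) g = sum g {0..<h}"
proof -
  have "ip (ibox h) g = (\<Sum>t\<in>{0..<h}. ibox h t * g t)"
    by (rule ip_eq_sum) (auto simp: ibox_def split: if_splits)
  also have "\<dots> = sum g {0..<h}" by (rule sum.cong) (auto simp: ibox_def)
  finally show ?thesis .
qed

lemma corr_cong:
  assumes "finite I" "\<And>i. i \<in> I \<Longrightarrow> W i = W' i"
  shows "corr h W I = corr h W' I"
  by (simp add: corr_def fun_eq_iff avg_cong[OF assms])

lemma corr_empty: "h > 0 \<Longrightarrow> corr h W {} 0 = 1"
  by (simp add: corr_def ip_ibox ibox_def)

lemma corr_le:
  assumes "finite I" "h > 0"
  shows "corr h W I u \<le> corr h W I 0"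
proof -
  let ?g = "avg W I (ibox h)"
  have fs: "finsupp ?g" by (intro finsupp_avg assms finsupp_ibox)
  have "ip ?g (\<lambda>t. ?g (t + u)) \<le> sqrt (ip ?g ?g * ip (\<lambda>t. ?g (t + u)) (\<lambda>t. ?g (t + u)))"
    by (intro ip_Cauchy_Schwarz finsupp_shift fs)
  also have "\<dots> = ip ?g ?g" unfolding ip_shift by (simp add: ip_self_nonneg)
  finally show ?thesis using assms unfolding corr_def by (simp add: divide_right_mono)
qed

lemma corr_nonneg: "h > 0 \<Longrightarrow> 0 \<le> corr h W I 0"
  by (simp add: corr_def ip_self_nonneg)

text \<open>The walk with \<open>i\<close> added is the mean of the translates of
  \<open>avg W I (ibox h)\<close> by \<open>W i\<close> and \<open>- W i\<close>. In its squared
  norm the diagonal terms give the value at 0, and the cross terms compare two copies at distance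
  \<open>2 * W i\<close>.\<close>

lemma corr_insert:
  assumes "finite I" "i \<notin> I"
  shows "corr h W (insert i I) 0 = (corr h W I 0 + corr h W I (2 * W i)) / 2"
proof -
  let ?g = "avg W I (ibox h)"
  have fs: "finsupp ?g" by (intro finsupp_avg assms finsupp_ibox)
  define a where "a = (\<lambda>t. ?g (t - W i))"
  define b where "b = (\<lambda>t. ?g (t + W i))"
  have fa: "finsupp a" and fb: "finsupp b"
    unfolding a_def b_def by (intro finsupp_shift finsupp_shift_diff fs)+
  have ab: "avg W (insert i I) (ibox h) = (\<lambda>t. (1/2) * a t + (1/2) * b t)"
    using assms by (auto simp: fun_eq_iff a_def b_def field_simps)
  have aa: "ip a a = ip ?g ?g" using ip_shift[of ?g "- W i" ?g] by (simp add: a_def)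
  have bb: "ip b b = ip ?g ?g" using ip_shift[of ?g "W i" ?g] by (simp add: b_def)
  have abip: "ip a b = ip ?g (\<lambda>t. ?g (t + 2 * W i))"
    using ip_shift[of ?g "- W i" "\<lambda>t. ?g (t + 2 * W i)"] by (simp add: a_def b_def add.commute)
  have "ip (\<lambda>t. (1/2) * a t + (1/2) * b t) (\<lambda>t. (1/2) * a t + (1/2) * b t)
      = (1/2) * ((1/2) * ip a a + (1/2) * ip a b) + (1/2) * ((1/2) * ip b a + (1/2) * ip b b)"
    by (simp only: ip_comb_left[OF fa fb] ip_comb_right)
  also have "\<dots> = (ip ?g ?g + ip ?g (\<lambda>t. ?g (t + 2 * W i))) / 2"
    unfolding ip_commute[OF fb fa] aa bb abip by (simp add: field_simps)
  finally show ?thesis unfolding corr_def ab by (simp add: add_divide_distrib)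
qed

text \<open>By \<open>corr_insert\<close> each new coordinate averages the old value at 0 with
  another value, which by \<open>corr_le\<close> is no larger.\<close>

lemma corr_mono:
  assumes "finite H" "I \<subseteq> H" "h > 0"
  shows "corr h W H 0 \<le> corr h W I 0"
proof -
  have "corr h W (I \<union> D) 0 \<le> corr h W I 0" if "finite D" "D \<inter> I = {}" for D
    using that
  proof (induction D rule: finite_induct)
    case (insert i D)
    have fin: "finite (I \<union> D)" using insert assms finite_subset by auto
    have "corr h W (insert i (I \<union> D)) 0 \<le> corr h W (I \<union> D) 0"
      using corr_le[OF fin assms(3), of W "2 * W i"] insert
      by (subst corr_insert[OF fin]) auto
    then show ?case using insert by simp
  qed auto
  from this[of "H - I"] assms show ?thesis
    by (simp add: Un_absorb1 Int_commute Diff_triv)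
qed

lemma corr_le_1:
  assumes "finite H" "h > 0"
  shows "corr h W H 0 \<le> 1"
  using corr_mono[of H "{}" h W] corr_empty[of h W] assms by simp

text \<open>The drop of the autocorrelation below its maximum is, up to a constant, the squared
  distance between a function and its translate. This is the source of subadditivity.\<close>

lemma corr_defect:
  assumes "finite I" "h > 0"
  shows "ip (\<lambda>t. avg W I (ibox h) t - avg W I (ibox h) (t + u)) (\<lambda>t. avg W I (ibox h) t - avg W I (ibox h) (t + u))
    = 2 * real_of_int h * (corr h W I 0 - corr h W I u)"
proof -
  let ?g = "avg W I (ibox h)"
  define b where "b = (\<lambda>t. ?g (t + u))"
  have fa: "finsupp ?g" by (intro finsupp_avg assms finsupp_ibox)
  have fb: "finsupp b" unfolding b_def by (intro finsupp_shift fa)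
  have eq: "(\<lambda>t. ?g t - ?g (t + u)) = (\<lambda>t. 1 * ?g t + (-1) * b t)"
    by (simp add: b_def)
  have bb: "ip b b = ip ?g ?g" using ip_shift[of ?g "u" ?g] by (simp add: b_def)
  have "ip (\<lambda>t. 1 * ?g t + (-1) * b t) (\<lambda>t. 1 * ?g t + (-1) * b t)
      = 1 * (1 * ip ?g ?g + (-1) * ip ?g b) + (-1) * (1 * ip b ?g + (-1) * ip b b)"
    by (simp only: ip_comb_left[OF fa fb] ip_comb_right)
  also have "\<dots> = 2 * (ip ?g ?g - ip ?g b)" unfolding ip_commute[OF fb fa] bb by simp
  finally have "ip (\<lambda>t. ?g t - ?g (t + u)) (\<lambda>t. ?g t - ?g (t + u)) = 2 * (ip ?g ?g - ip ?g b)"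
    unfolding eq .
  then show ?thesis using assms by (simp add: corr_def b_def diff_divide_distrib[symmetric])
qed

text \<open>Go from the function to its translate by \<open>u + v\<close> through the translate by
  \<open>u\<close>; translation invariance turns the second leg into the defect at
  \<open>v\<close>.\<close>

lemma corr_defect_add:
  assumes "finite I" "h > 0"
  shows "sqrt (corr h W I 0 - corr h W I (u + v))
    \<le> sqrt (corr h W I 0 - corr h W I u) + sqrt (corr h W I 0 - corr h W I v)"
proof -
  let ?g = "avg W I (ibox h)"
  have fa: "finsupp ?g" by (intro finsupp_avg assms finsupp_ibox)
  define d where "d = (\<lambda>u t. ?g t - ?g (t + u))"
  define q where "q = (\<lambda>u. corr h W I 0 - corr h W I u)"
  have fd: "finsupp (d u)" for u
    using finsupp_comb[OF fa finsupp_shift[OF fa], of 1 "-1" u] by (simp add: d_def)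
  have ipd: "ip (d u) (d u) = 2 * real_of_int h * q u" for u
    unfolding d_def q_def by (rule corr_defect[OF assms])
  have split: "d (u + v) = (\<lambda>t. d u t + d v (t + u))"
    by (auto simp: d_def fun_eq_iff algebra_simps)
  have "sqrt (ip (d (u + v)) (d (u + v))) \<le> sqrt (ip (d u) (d u)) + sqrt (ip (\<lambda>t. d v (t + u)) (\<lambda>t. d v (t + u)))"
    unfolding split by (intro ip_triangle finsupp_shift fd)
  then have "sqrt (2 * real_of_int h) * sqrt (q (u + v)) \<le> sqrt (2 * real_of_int h) * (sqrt (q u) + sqrt (q v))"
    unfolding ip_shift[of "d v" u "d v"] ipd real_sqrt_mult by (simp add: algebra_simps)
  then show ?thesis using assms unfolding q_def by simp
qed

lemma corr_defect_mult:
  assumes "finite I" "h > 0"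
  shows "sqrt (corr h W I 0 - corr h W I (int a * u)) \<le> real a * sqrt (corr h W I 0 - corr h W I u)"
proof (induction a)
  case (Suc a)
  have "sqrt (corr h W I 0 - corr h W I (int (Suc a) * u))
    \<le> sqrt (corr h W I 0 - corr h W I u) + sqrt (corr h W I 0 - corr h W I (int a * u))"
    using corr_defect_add[OF assms, of W u "int a * u"] by (simp add: algebra_simps)
  then show ?case using Suc by (simp add: algebra_simps)
qed simp

lemma sum_ibox_le_1:
  assumes "\<And>s t. s \<in> A \<Longrightarrow> t \<in> A \<Longrightarrow> s \<noteq> t \<Longrightarrow> h \<le> \<bar>y s - y t\<bar>" "finite A"
  shows "(\<Sum>s\<in>A. ibox h (x + y s)) \<le> 1"
proof -
  let ?S = "{s \<in> A. 0 \<le> x + y s \<and> x + y s < h}"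
  have "(\<Sum>s\<in>A. ibox h (x + y s)) = real (card ?S)"
    using assms(2) by (simp add: ibox_def of_bool_def sum.If_cases Int_def)
  moreover have "card ?S \<le> 1"
    using assms by (fastforce simp: card_le_Suc0_iff_eq)
  ultimately show ?thesis by simp
qed

text \<open>Move the sum inside the inner product. A window of length \<open>h\<close> contains at
  most one of the separated points, so the translated boxes add up to at most 1 pointwise, and
  averaging preserves this. What remains is the total mass \<open>h\<close> of the averaged box,
  which the normalisation cancels.\<close>

lemma sum_corr_le_1:
  assumes "finite I" "h > 0" "finite A"
    "\<And>s t. s \<in> A \<Longrightarrow> t \<in> A \<Longrightarrow> s \<noteq> t \<Longrightarrow> h \<le> \<bar>y s - y t\<bar>"
  shows "(\<Sum>s\<in>A. corr h W I (y s)) \<le> 1"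
proof -
  let ?g = "avg W I (ibox h)"
  have fs: "finsupp ?g" by (intro finsupp_avg assms finsupp_ibox)
  have nn: "0 \<le> ?g t" for t
    using avg_mono[OF assms(1), of "\<lambda>_. 0" "ibox h" W t] avg_const[OF assms(1), of W 0 t]
    by (simp add: ibox_def)
  have le1: "(\<Sum>s\<in>A. ?g (x + y s)) \<le> 1" for x
    using assms(1)
  proof (induction I arbitrary: x rule: finite_induct)
    case (insert i I)
    have "(\<Sum>s\<in>A. avg W (insert i I) (ibox h) (x + y s))
       = ((\<Sum>s\<in>A. avg W I (ibox h) ((x - W i) + y s)) + (\<Sum>s\<in>A. avg W I (ibox h) ((x + W i) + y s))) / 2"
      using insert.hyps by (simp add: sum.distrib[symmetric] sum_divide_distrib algebra_simps)
    then show ?case using insert.IH[of "x - W i"] insert.IH[of "x + W i"] by simp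
  qed (use sum_ibox_le_1[of A h y] assms in auto)
  have mass: "ip ?g (\<lambda>_. 1) = real_of_int h"
    using assms(1)
  proof (induction I rule: finite_induct)
    case empty
    then show ?case using assms(2) by (simp add: ip_ibox)
  next
    case (insert i I)
    have eq: "avg W (insert i I) (ibox h) = (\<lambda>t. (1/2) * avg W I (ibox h) (t - W i) + (1/2) * avg W I (ibox h) (t + W i))"
      using insert.hyps by (auto simp: fun_eq_iff field_simps)
    have fs': "finsupp (avg W I (ibox h))" by (intro finsupp_avg insert finsupp_ibox)
    show ?case
      unfolding eq ip_comb_left[OF finsupp_shift_diff[OF fs'] finsupp_shift[OF fs']]
      using insert.IH ip_shift[of "avg W I (ibox h)" "- W i" "\<lambda>_. 1"] ip_shift[of "avg W I (ibox h)" "W i" "\<lambda>_. 1"]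
      by simp
  qed
  have "(\<Sum>s\<in>A. ip ?g (\<lambda>t. ?g (t + y s))) = (\<Sum>t | ?g t \<noteq> 0. ?g t * (\<Sum>s\<in>A. ?g (t + y s)))"
    unfolding ip_def by (subst sum.swap) (simp add: sum_distrib_left)
  also have "\<dots> \<le> (\<Sum>t | ?g t \<noteq> 0. ?g t * 1)"
    by (intro sum_mono mult_left_mono le1 nn)
  also have "\<dots> = real_of_int h" using mass by (simp add: ip_def)
  finally show ?thesis using assms(2) unfolding corr_def
    by (simp add: sum_divide_distrib[symmetric])
qed

section \<open>Concentration, greedy subsets and nets\<close>

lemma ip_reflect: "ip (\<lambda>t. f (z - t)) (\<lambda>t. g (z - t)) = ip f g"
  unfolding ip_def
  by (rule sum.reindex_bij_witness[where i = "\<lambda>t. z - t" and j = "\<lambda>t. z - t"]) auto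

lemma finsupp_reflect: "finsupp f \<Longrightarrow> finsupp (\<lambda>t. f (z - t))"
proof -
  assume "finsupp f"
  moreover have "{t. f (z - t) \<noteq> 0} = (\<lambda>t. z - t) ` {t. f t \<noteq> 0}"
    by (force simp: image_iff intro: exI[of _ "z - _"])
  ultimately show ?thesis by (simp add: finsupp_def)
qed

text \<open>The law of a sum of two independent walks is a convolution: averaging over
  \<open>I\<close> acts on one factor and averaging over \<open>J\<close> on the other.\<close>

lemma avg_convolution:
  assumes "finite I" "finite J" "I \<inter> J = {}" "finsupp f"
  shows "avg W (I \<union> J) (\<lambda>z. ip f (\<lambda>s. g (z - s))) z = ip (avg W I f) (\<lambda>s. avg W J g (z - s))"
  using assms(1,3)
proof (induction I arbitrary: z rule: finite_induct)
  case empty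
  have "avg W J (\<lambda>z. ip f (\<lambda>s. g (z - s))) z = ip f (\<lambda>s. avg W J g (z - s))"
    using assms(2)
  proof (induction J arbitrary: z rule: finite_induct)
    case (insert j J)
    have "(\<lambda>s. avg W (insert j J) g (z - s))
      = (\<lambda>s. (1/2) * avg W J g ((z - W j) - s) + (1/2) * avg W J g ((z + W j) - s))"
      using insert.hyps by (auto simp: fun_eq_iff field_simps)
    then show ?case using insert.hyps by (simp only: ip_comb_right) (simp add: insert.IH)
  qed simp
  then show ?case by simp
next
  case (insert i I)
  have fs: "finsupp (avg W I f)" using insert assms by (intro finsupp_avg)
  have eq: "avg W (insert i I) f = (\<lambda>t. (1/2) * avg W I f (t - W i) + (1/2) * avg W I f (t + W i))"
    using insert.hyps by (auto simp: fun_eq_iff field_simps)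
  have 1: "ip (\<lambda>t. avg W I f (t - W i)) (\<lambda>s. avg W J g (z - s)) = ip (avg W I f) (\<lambda>s. avg W J g ((z - W i) - s))"
    using ip_shift[of "avg W I f" "- W i" "\<lambda>s. avg W J g ((z - W i) - s)"] by simp
  have 2: "ip (\<lambda>t. avg W I f (t + W i)) (\<lambda>s. avg W J g (z - s)) = ip (avg W I f) (\<lambda>s. avg W J g ((z + W i) - s))"
    using ip_shift[of "avg W I f" "W i" "\<lambda>s. avg W J g ((z + W i) - s)"] by simp
  have "finite (I \<union> J)" "i \<notin> I \<union> J" using insert assms by auto
  then show ?case
    unfolding eq ip_comb_left[OF finsupp_shift_diff[OF fs] finsupp_shift[OF fs]] 1 2
    using insert by simp
qed

text \<open>The convolution of two boxes is a tent of height \<open>h\<close>. The shift by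
  \<open>h - 1\<close> centres it at 0, and its value \<open>h - \<bar>t\<bar>\<close> is at least
  \<open>h / 2\<close> on the ball.\<close>

lemma iball_le_convolution:
  assumes "h > 0" "2 * r \<le> h"
  shows "iball r t \<le> (2 / real_of_int h) * ip (ibox h) (\<lambda>s. ibox h ((t + (h - 1)) - s))"
proof (cases "\<bar>t\<bar> \<le> r")
  case True
  let ?A = "{max 0 t..min (h - 1) (t + (h - 1))}"
  have "h \<le> 2 * int (card ?A)" using True assms by (auto simp: max_def min_def)
  then have "real_of_int h / 2 \<le> real (card ?A)" by linarith
  also have "\<dots> = (\<Sum>s\<in>?A. 1)" by simp
  also have "\<dots> = (\<Sum>s\<in>?A. ibox h ((t + (h - 1)) - s))"
    by (intro sum.cong) (auto simp: ibox_def)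
  also have "\<dots> \<le> (\<Sum>s\<in>{0..<h}. ibox h ((t + (h - 1)) - s))"
    by (rule sum_mono2) (auto simp: ibox_def)
  finally show ?thesis using True assms by (simp add: iball_def ip_ibox field_simps)
qed (use assms in \<open>auto simp: iball_def ip_ibox ibox_def intro!: mult_nonneg_nonneg sum_nonneg divide_nonneg_nonneg\<close>)

text \<open>Dominate the ball by the tent, whose convolution form separates the two sets of
  coordinates; Cauchy-Schwarz then leaves one norm for each set. The bound is uniform in the centre
  \<open>z\<close> because reflection preserves norms.\<close>

lemma avg_iball_le_corr:
  assumes "finite I" "finite J" "I \<inter> J = {}" "h > 0" "2 * r \<le> h"
  shows "avg W (I \<union> J) (iball r) z \<le> 2 * sqrt (corr h W I 0 * corr h W J 0)"
proof -
  let ?c = "\<lambda>t. ip (ibox h) (\<lambda>s. ibox h (t - s))"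
  let ?f = "avg W I (ibox h)" and ?g = "avg W J (ibox h)"
  have fin: "finite (I \<union> J)" using assms by simp
  have fs: "finsupp ?f" "finsupp ?g" by (intro finsupp_avg assms finsupp_ibox)+
  have "avg W (I \<union> J) (iball r) z \<le> avg W (I \<union> J) (\<lambda>t. (2 / real_of_int h) * ?c (t + (h - 1))) z"
    using fin by (rule avg_mono) (rule iball_le_convolution[OF assms(4,5)])
  also have "\<dots> = (2 / real_of_int h) * avg W (I \<union> J) ?c (z + (h - 1))"
    unfolding avg_scale[OF fin] by (simp add: avg_shift[OF fin, of W ?c])
  also have "avg W (I \<union> J) ?c (z + (h - 1)) = ip ?f (\<lambda>s. ?g ((z + (h - 1)) - s))"
    using assms by (intro avg_convolution finsupp_ibox)
  also have "(2 / real_of_int h) * \<dots> \<le> (2 / real_of_int h) * sqrt (ip ?f ?f * ip ?g ?g)"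
    using ip_Cauchy_Schwarz[OF fs(1) finsupp_reflect[OF fs(2)], of "z + (h - 1)"] assms(4)
    unfolding ip_reflect by (intro mult_left_mono) auto
  also have "\<dots> = 2 * sqrt (corr h W I 0 * corr h W J 0)"
    using assms(4) by (simp add: corr_def real_sqrt_divide)
  finally show ?thesis .
qed

text \<open>Fix all signs except that of \<open>i\<close>: the two possible sums are more than
  \<open>2 * r\<close> apart, so at most one of them hits the ball. This is the bound used when both
  nets are single points.\<close>

lemma avg_iball_le_half:
  assumes "finite I" "i \<in> I" "r < \<bar>W i\<bar>"
  shows "avg W I (iball r) z \<le> 1 / 2"
proof -
  let ?J = "I - {i}"
  have fin: "finite ?J" using assms by simp
  have "avg W (insert i ?J) (iball r) z = (avg W ?J (iball r) (z - W i) + avg W ?J (iball r) (z + W i)) / 2"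
    using fin by (rule avg_insert) simp
  also have "avg W ?J (iball r) (z - W i) = avg W ?J (\<lambda>t. iball r (t - W i)) z"
    using avg_shift[OF fin, of W "iball r" "- W i" z] by simp
  also have "avg W ?J (iball r) (z + W i) = avg W ?J (\<lambda>t. iball r (t + W i)) z"
    using avg_shift[OF fin, of W "iball r" "W i" z] by simp
  also have "(avg W ?J (\<lambda>t. iball r (t - W i)) z + avg W ?J (\<lambda>t. iball r (t + W i)) z) \<le> 1"
  proof -
    \<comment> \<open>The balls around \<open>W i\<close> and \<open>- W i\<close> are disjoint, so
      one indicator is at most 1 minus the other.\<close>
    have "avg W ?J (\<lambda>t. iball r (t - W i)) z \<le> avg W ?J (\<lambda>t. 1 + (- 1) * iball r (t + W i)) z"
      using fin by (rule avg_mono) (use assms(3) in \<open>auto simp: iball_def\<close>)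
    also have "\<dots> = 1 - avg W ?J (\<lambda>t. iball r (t + W i)) z"
      using fin by (simp only: avg_add avg_const avg_scale)
    finally show ?thesis by simp
  qed
  finally show ?thesis using assms by (simp add: insert_absorb)
qed

text \<open>Each sign moves the two sums apart by at most \<open>d\<close>, hence the enlarged
  radius. The slack \<open>e\<close> between the centres lets the induction absorb this
  drift.\<close>

lemma avg_iball_perturb:
  assumes "finite I" "\<And>i. i \<in> I \<Longrightarrow> \<bar>W i - W' i\<bar> \<le> d" "\<bar>z - z'\<bar> \<le> e"
  shows "avg W' I (iball r) z \<le> avg W I (iball (r + e + d * int (card I))) z'"
  using assms
proof (induction I arbitrary: z z' e rule: finite_induct)
  case empty
  then show ?case by (auto simp: iball_def)
next
  case (insert i I)
  have "\<bar>W i - W' i\<bar> \<le> d" using insert.prems by simp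
  then have "avg W' I (iball r) (z - W' i) \<le> avg W I (iball (r + (e + d) + d * int (card I))) (z' - W i)"
    "avg W' I (iball r) (z + W' i) \<le> avg W I (iball (r + (e + d) + d * int (card I))) (z' + W i)"
    using insert.prems(1) insert.prems(2) by (intro insert.IH; force)+
  moreover have "r + (e + d) + d * int (card I) = r + e + d * int (card (insert i I))"
    using insert.hyps by (simp add: algebra_simps)
  ultimately show ?case using insert.hyps by simp
qed

text \<open>Take a subset of greatest size obeying the decay bound. If a remaining coordinate
  violated the level-set inequality, then by \<open>corr_insert\<close> adding it would gain a
  further factor \<open>1 - \<epsilon> / 2\<close>, against maximality.\<close>

lemma greedy_subset:
  assumes "finite H" "h > 0" "0 < \<epsilon>" "\<epsilon> < 2"
  shows "\<exists>I\<subseteq>H. corr h W I 0 \<le> (1 - \<epsilon> / 2) ^ card I \<and>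
    (\<forall>i\<in>H - I. (1 - \<epsilon>) * corr h W I 0 \<le> corr h W I (2 * W i))"
proof -
  define P where "P I \<longleftrightarrow> I \<subseteq> H \<and> corr h W I 0 \<le> (1 - \<epsilon> / 2) ^ card I" for I
  have "P {}" using assms by (simp add: P_def corr_empty)
  moreover have "\<forall>I. P I \<longrightarrow> card I < Suc (card H)"
    using assms by (auto simp: P_def less_Suc_eq_le card_mono)
  ultimately obtain I where I: "P I" "\<forall>J. P J \<longrightarrow> card J \<le> card I"
    using ex_has_greatest_nat[of P "{}" card "Suc (card H)"] by auto
  have fin: "finite I" using I(1) assms finite_subset by (auto simp: P_def)
  have "(1 - \<epsilon>) * corr h W I 0 \<le> corr h W I (2 * W i)" if "i \<in> H - I" for i
  proof (rule ccontr)
    assume "\<not> ?thesis"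
    then have "corr h W (insert i I) 0 \<le> (1 - \<epsilon> / 2) * corr h W I 0"
      using corr_insert[OF fin, of i h W] that by (simp add: algebra_simps)
    also have "\<dots> \<le> (1 - \<epsilon> / 2) * (1 - \<epsilon> / 2) ^ card I"
      using I(1) assms by (intro mult_left_mono) (auto simp: P_def)
    finally have "P (insert i I)" using I(1) that fin by (simp add: P_def)
    then show False using I(2)[rule_format, of "insert i I"] that fin by simp
  qed
  then show ?thesis using I(1) unfolding P_def by blast
qed

text \<open>The points \<open>(m - a) v\<^sub>i + a v\<^sub>i\<^sub>+\<^sub>1\<close> interpolating \<open>m\<close>-fold between consecutive elements of
  \<open>N\<close> are still separated, and subadditivity of the square root of the defect makes the
  autocorrelation at least \<open>q / 2\<close> on them; so a level set near the maximum is \<open>m\<close> times smaller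
  than what the total mass alone gives.\<close>

lemma card_separated_level_set:
  assumes "finite I" "h > 0" "m > 0" "corr h W I 0 > 0" "finite N" "N \<noteq> {}"
    and lev: "\<And>v. v \<in> N \<Longrightarrow> (1 - 1 / (2 * real m ^ 2)) * corr h W I 0 \<le> corr h W I (2 * v)"
    and sep: "\<And>v w. v \<in> N \<Longrightarrow> w \<in> N \<Longrightarrow> v \<noteq> w \<Longrightarrow> h \<le> \<bar>v - w\<bar>"
  shows "real (card N) \<le> 1 + 2 / (real m * corr h W I 0)"
proof -
  define q where "q = corr h W I 0"
  define xs where "xs = sorted_list_of_set N"
  define r where "r = card N"
  have r: "r > 0" using assms by (simp add: r_def card_gt_0_iff)
  have xs: "length xs = r" "set xs = N" "sorted_wrt (<) xs"
    using assms by (auto simp: xs_def r_def)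
  have step: "xs ! i + h \<le> xs ! Suc i" if "Suc i < r" for i
  proof -
    have "xs ! i < xs ! Suc i" using xs that by (simp add: sorted_wrt_iff_nth_less)
    moreover have "xs ! i \<in> N" "xs ! Suc i \<in> N" using xs that nth_mem[of _ xs] by auto
    ultimately show ?thesis using sep[of "xs ! i" "xs ! Suc i"] by simp
  qed
  \<comment> \<open>For \<open>i = t div m\<close> the points move from
    \<open>m * (2 * xs ! i)\<close> to \<open>m * (2 * xs ! Suc i)\<close> in \<open>m\<close> equal
    steps. The doubling matches the argument \<open>2 * v\<close> in the level-set
    hypothesis.\<close>
  define y where "y t = (int m - int (t mod m)) * (2 * xs ! (t div m)) + int (t mod m) * (2 * xs ! Suc (t div m))" for t
  have ystep: "y t + h \<le> y (Suc t)" if "t < m * (r - 1)" for t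
  proof -
    let ?i = "t div m"
    have "?i < r - 1" using that assms(3) by (simp add: less_mult_imp_div_less mult.commute)
    then have si: "xs ! ?i + h \<le> xs ! Suc ?i" using step[of ?i] by simp
    have "y (Suc t) - y t = 2 * (xs ! Suc ?i - xs ! ?i)"
    proof (cases "Suc (t mod m) = m")
      case True
      then have m: "int m - int (t mod m) = 1" "int m = 1 + int (t mod m)" by linarith+
      have "y t = 2 * xs ! ?i + int (t mod m) * (2 * xs ! Suc ?i)"
        unfolding y_def m(1) by simp
      moreover have "y (Suc t) = (1 + int (t mod m)) * (2 * xs ! Suc ?i)"
        unfolding m(2)[symmetric] using True by (simp add: y_def mod_Suc div_Suc)
      ultimately show ?thesis by (simp add: algebra_simps)
    next
      case False
      then show ?thesis by (simp add: y_def mod_Suc div_Suc algebra_simps)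
    qed
    moreover have "c + h \<le> d" if "d - c = 2 * (b - a)" "a + h \<le> b" for a b c d :: int
      using that assms(2) by (auto simp: algebra_simps)
    ultimately show ?thesis using si by blast
  qed
  have ymono: "y s + h \<le> y t" if "s < t" "t \<le> m * (r - 1)" for s t
    using that
  proof (induction t)
    case (Suc t)
    then show ?case using ystep[of t] assms(2) by (cases "s = t") auto
  qed simp
  \<comment> \<open>An \<open>m\<close>-fold sum has root defect at most \<open>m\<close> times
    \<open>sqrt (q / (2 * m^2))\<close>, which is \<open>sqrt (q / 2)\<close>; the constant of the
    level set is chosen for this.\<close>
  have half: "q / 2 \<le> corr h W I (y t)" if "t \<le> m * (r - 1)" for t
  proof -
    let ?i = "t div m" and ?a = "t mod m"
    let ?d = "\<lambda>u. sqrt (q - corr h W I u)"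
    have am: "?a < m" using assms(3) by simp
    have dN: "?d (2 * v) \<le> sqrt (q / (2 * real m ^ 2))" if "v \<in> N" for v
      using lev[OF that] by (simp add: q_def algebra_simps)
    have "?i \<le> r - 1" using div_le_mono[OF that, of m] assms(3) by simp
    then have i: "xs ! ?i \<in> N" using xs r nth_mem[of ?i xs] by simp
    have 1: "real (m - ?a) * ?d (2 * xs ! ?i) \<le> real (m - ?a) * sqrt (q / (2 * real m ^ 2))"
      by (intro mult_left_mono dN i) auto
    have 2: "real ?a * ?d (2 * xs ! Suc ?i) \<le> real ?a * sqrt (q / (2 * real m ^ 2))"
    \<comment> \<open>At the last point \<open>Suc ?i\<close> is out of range, but its weight
      \<open>?a\<close> is 0 there.\<close>
    proof (cases "?a = 0")
      case False
      have "Suc ?i < r"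
      proof (rule ccontr)
        assume "\<not> ?thesis"
        then have "?i = r - 1" using \<open>?i \<le> r - 1\<close> by simp
        then have "t = m * (r - 1) + ?a" by (metis mult_div_mod_eq)
        then show False using that False by simp
      qed
      then have "xs ! Suc ?i \<in> N" using xs nth_mem[of "Suc ?i" xs] by simp
      then show ?thesis by (intro mult_left_mono dN) auto
    qed simp
    have "?d (y t) \<le> ?d (int (m - ?a) * (2 * xs ! ?i)) + ?d (int ?a * (2 * xs ! Suc ?i))"
      using corr_defect_add[OF assms(1,2)] am unfolding y_def q_def by (simp add: of_nat_diff)
    also have "\<dots> \<le> real (m - ?a) * ?d (2 * xs ! ?i) + real ?a * ?d (2 * xs ! Suc ?i)"
      unfolding q_def by (intro add_mono corr_defect_mult assms)
    also have "\<dots> \<le> real (m - ?a) * sqrt (q / (2 * real m ^ 2)) + real ?a * sqrt (q / (2 * real m ^ 2))"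
      using 1 2 by (rule add_mono)
    also have "\<dots> = real m * sqrt (q / (2 * real m ^ 2))"
      using am by (simp add: of_nat_diff algebra_simps)
    also have "\<dots> = sqrt (q / 2)"
      using assms(3) by (simp add: real_sqrt_divide real_sqrt_mult)
    finally show ?thesis by simp
  qed
  have "(\<Sum>t\<in>{..m * (r - 1)}. corr h W I (y t)) \<le> 1"
  proof (rule sum_corr_le_1[OF assms(1,2)])
    fix s t assume "s \<in> {..m * (r - 1)}" "t \<in> {..m * (r - 1)}" "s \<noteq> t"
    then show "h \<le> \<bar>y s - y t\<bar>" using ymono[of s t] ymono[of t s] by (cases "s < t") auto
  qed simp
  moreover have "(\<Sum>t\<in>{..m * (r - 1)}. q / 2) \<le> (\<Sum>t\<in>{..m * (r - 1)}. corr h W I (y t))"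
    by (intro sum_mono half) simp
  \<comment> \<open>There are \<open>m * (r - 1) + 1\<close> separated points, each contributing at
    least \<open>q / 2\<close>.\<close>
  ultimately have "(real m * (real r - 1) + 1) * (q / 2) \<le> 1" using r by (simp add: of_nat_diff algebra_simps)
  moreover have "q > 0" using assms by (simp add: q_def)
  ultimately have "real m * (real r - 1) \<le> 2 / q" by (simp add: field_simps)
  then have "real r - 1 \<le> (2 / q) / real m"
    by (subst pos_le_divide_eq) (use assms(3) in \<open>auto simp: mult.commute\<close>)
  then show ?thesis by (simp add: r_def q_def mult.commute)
qed

text \<open>A maximal separated subset of the level set is a net. One of greatest size exists, since
  \<open>card_separated_level_set\<close> bounds the sizes and \<open>{0}\<close> is such a
  subset.\<close>

lemma level_set_net:
  assumes "finite I" "h > 0" "m > 0" "corr h W I 0 > 0"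
  shows "\<exists>N. finite N \<and> N \<noteq> {} \<and> real (card N) \<le> 1 + 2 / (real m * corr h W I 0) \<and>
    (\<forall>v. (1 - 1 / (2 * real m ^ 2)) * corr h W I 0 \<le> corr h W I (2 * v) \<longrightarrow> (\<exists>y\<in>N. \<bar>v - y\<bar> \<le> h))"
proof -
  let ?L = "{v. (1 - 1 / (2 * real m ^ 2)) * corr h W I 0 \<le> corr h W I (2 * v)}"
  define P where "P N \<longleftrightarrow> finite N \<and> N \<noteq> {} \<and> N \<subseteq> ?L \<and> (\<forall>v\<in>N. \<forall>w\<in>N. v \<noteq> w \<longrightarrow> h \<le> \<bar>v - w\<bar>)" for N
  have bd: "real (card N) \<le> 1 + 2 / (real m * corr h W I 0)" if "P N" for N
    by (rule card_separated_level_set[OF assms]) (use that in \<open>auto simp: P_def\<close>)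
  have "P {0}" using assms(3,4) by (auto simp: P_def algebra_simps)
  moreover have "\<forall>N. P N \<longrightarrow> card N < Suc (nat \<lceil>1 + 2 / (real m * corr h W I 0)\<rceil>)"
    using bd real_nat_ceiling_ge[of "1 + 2 / (real m * corr h W I 0)"]
    by (meson le_imp_less_Suc of_nat_le_iff order_trans)
  ultimately obtain N where N: "P N" "\<forall>M. P M \<longrightarrow> card M \<le> card N"
    using ex_has_greatest_nat[of P "{0}" card] by blast
  have "\<exists>y\<in>N. \<bar>v - y\<bar> \<le> h" if v: "v \<in> ?L" for v
  proof (rule ccontr)
    assume no: "\<not> ?thesis"
    have "v \<notin> N" using no assms(2) by force
    have far: "h \<le> \<bar>v - w\<bar>" "h \<le> \<bar>w - v\<bar>" if "w \<in> N" for w using no that by force+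
    have "P (insert v N)" using N(1) v far unfolding P_def by auto
    then have "card (insert v N) \<le> card N" using N(2) by blast
    then show False using N(1) \<open>v \<notin> N\<close> by (simp add: P_def)
  qed
  then show ?thesis using N(1) bd[OF N(1)] unfolding P_def by (intro exI[of _ N]) auto
qed

section \<open>Random sign matrices\<close>

text \<open>Conditioning by Fubini: \<open>Y\<close> is revealed first, and each of its values
  satisfying \<open>R\<close> leaves conditional probability at most \<open>p\<close>.\<close>

lemma prob_pair_le:
  assumes "\<And>y. R y \<Longrightarrow> measure_pmf.prob X {x. P x y} \<le> p" "0 \<le> p"
  shows "measure_pmf.prob (pair_pmf Y X) {z. R (fst z) \<and> P (snd z) (fst z)} \<le> p * measure_pmf.prob Y {y. R y}"
proof -
  let ?S = "{z. R (fst z) \<and> P (snd z) (fst z)}"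
  have "emeasure (measure_pmf (pair_pmf Y X)) ?S = (\<integral>\<^sup>+z. indicator ?S z \<partial>measure_pmf (pair_pmf Y X))"
    by simp
  also have "\<dots> = (\<integral>\<^sup>+y. \<integral>\<^sup>+x. indicator ?S (y, x) \<partial>measure_pmf X \<partial>measure_pmf Y)"
    by (rule nn_integral_pair_pmf')
  also have "\<dots> \<le> (\<integral>\<^sup>+y. ennreal p * indicator {y. R y} y \<partial>measure_pmf Y)"
  proof (rule nn_integral_mono)
    fix y
    have "(\<integral>\<^sup>+x. indicator ?S (y, x) \<partial>measure_pmf X) = (\<integral>\<^sup>+x. indicator {x. R y \<and> P x y} x \<partial>measure_pmf X)"
      by (intro nn_integral_cong) (auto simp: indicator_def)
    also have "\<dots> = emeasure (measure_pmf X) {x. R y \<and> P x y}" by simp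
    also have "\<dots> \<le> ennreal p * indicator {y. R y} y"
      using assms by (cases "R y") (auto simp: measure_pmf.emeasure_eq_measure)
    finally show "(\<integral>\<^sup>+x. indicator ?S (y, x) \<partial>measure_pmf X) \<le> ennreal p * indicator {y. R y} y" .
  qed
  also have "\<dots> = ennreal (p * measure_pmf.prob Y {y. R y})"
    using assms(2) by (simp add: nn_integral_cmult measure_pmf.emeasure_eq_measure ennreal_mult)
  finally show ?thesis
    using assms(2) by (simp add: measure_pmf.emeasure_eq_measure)
qed

abbreviation coin :: "real pmf" where
  "coin \<equiv> pmf_of_set {-1, 1}"

lemma prob_bind_coin:
  "measure_pmf.prob (bind_pmf coin f) A = (measure_pmf.prob (f (-1)) A + measure_pmf.prob (f 1) A) / 2"
proof -
  have "ennreal (measure_pmf.prob (bind_pmf coin f) A) = emeasure (bind_pmf coin f) A"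
    by (simp add: measure_pmf.emeasure_eq_measure)
  also have "\<dots> = (emeasure (f (-1)) A + emeasure (f 1) A) / 2"
    by (simp add: nn_integral_pmf_of_set)
  also have "\<dots> = ennreal ((measure_pmf.prob (f (-1)) A + measure_pmf.prob (f 1) A) / 2)"
    by (simp add: measure_pmf.emeasure_eq_measure ennreal_plus[symmetric] ennreal_divide_numeral del: ennreal_plus)
  finally show ?thesis by simp
qed

text \<open>The bridge from probability to the averages: revealing one coin is one step of
  \<open>avg\<close>.\<close>

lemma prob_linear_form:
  assumes "finite I"
  shows "measure_pmf.prob (Pi_pmf I 0 (\<lambda>_. coin))
      {\<xi>. \<bar>real_of_int z + (\<Sum>i\<in>I. real_of_int (W i) * \<xi> i)\<bar> \<le> real_of_int r} = avg W I (iball r) z"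
  using assms
proof (induction I arbitrary: z rule: finite_induct)
  case empty
  have "\<bar>real_of_int z\<bar> \<le> real_of_int r \<longleftrightarrow> \<bar>z\<bar> \<le> r" by linarith
  then show ?case by (simp add: iball_def indicator_def)
next
  case (insert i I)
  let ?Q = "Pi_pmf I 0 (\<lambda>_. coin)"
  let ?S = "\<lambda>z I. {\<xi>. \<bar>real_of_int z + (\<Sum>i\<in>I. real_of_int (W i) * \<xi> i)\<bar> \<le> real_of_int r}"
  have Pi: "Pi_pmf (insert i I) 0 (\<lambda>_. coin) = bind_pmf coin (\<lambda>y. map_pmf (\<lambda>f. f(i := y)) ?Q)"
    unfolding Pi_pmf_insert'[OF insert.hyps] map_pmf_def ..
  have sum_upd: "(\<Sum>j\<in>I. real_of_int (W j) * (f(i := y)) j) = (\<Sum>j\<in>I. real_of_int (W j) * f j)" for f y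
    by (rule sum.cong) (use insert.hyps in auto)
  have "measure_pmf.prob (map_pmf (\<lambda>f. f(i := - 1)) ?Q) (?S z (insert i I)) = measure_pmf.prob ?Q (?S (z - W i) I)"
    unfolding measure_map_pmf vimage_def
    by (rule arg_cong[where f = "measure_pmf.prob ?Q"]) (use insert.hyps in \<open>auto simp: sum_upd algebra_simps simp del: fun_upd_apply simp: fun_upd_same\<close>)
  moreover have "measure_pmf.prob (map_pmf (\<lambda>f. f(i := 1)) ?Q) (?S z (insert i I)) = measure_pmf.prob ?Q (?S (z + W i) I)"
    unfolding measure_map_pmf vimage_def
    by (rule arg_cong[where f = "measure_pmf.prob ?Q"]) (use insert.hyps in \<open>auto simp: sum_upd algebra_simps simp del: fun_upd_apply simp: fun_upd_same\<close>)
  ultimately show ?case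
    unfolding Pi prob_bind_coin insert.IH using insert.hyps by simp
qed

lemma prob_linear_form_column:
  assumes "finite R"
  shows "measure_pmf.prob (Pi_pmf (R \<times> {j}) 0 (\<lambda>_. coin))
      {\<xi>. \<bar>real_of_int z + (\<Sum>k\<in>R. real_of_int (W k) * \<xi> (k, j))\<bar> \<le> real_of_int r} = avg W R (iball r) z"
proof -
  have "(\<Sum>k\<in>R. real_of_int (W k) * \<xi> (k, j)) = (\<Sum>x\<in>R \<times> {j}. real_of_int (W (fst x)) * \<xi> x)" for \<xi>
    by (rule sum.reindex_bij_witness[where i = fst and j = "\<lambda>k. (k, j)"]) auto
  then show ?thesis
    using prob_linear_form[of "R \<times> {j}" z "\<lambda>x. W (fst x)" r] assms avg_reindex_fst[OF assms, of W j "iball r"]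
    by simp
qed

text \<open>Columns are independent, and each constrained one contributes a factor \<open>p\<close>.
  Intersecting with \<open>J'\<close> allows a column of the full matrix to stay
  unconstrained.\<close>

lemma prob_columns_le:
  fixes W :: "'k \<Rightarrow> int" and c :: "'j \<Rightarrow> int"
  assumes "finite R" "finite J" "\<And>z. avg W R (iball r) z \<le> p" "0 \<le> p"
  shows "measure_pmf.prob (Pi_pmf (R \<times> J) 0 (\<lambda>_. coin))
      {\<xi>. \<forall>j\<in>J \<inter> J'. \<bar>real_of_int (c j) + (\<Sum>k\<in>R. real_of_int (W k) * \<xi> (k, j))\<bar> \<le> real_of_int r}
    \<le> p ^ card (J \<inter> J')"
  using assms(2)
proof (induction J rule: finite_induct)
  case (insert j J)
  let ?C = "\<lambda>j \<xi>. \<bar>real_of_int (c j) + (\<Sum>k\<in>R. real_of_int (W k) * \<xi> (k, j))\<bar> \<le> real_of_int r"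
  let ?A = "Pi_pmf (R \<times> J) 0 (\<lambda>_. coin)" and ?B = "Pi_pmf (R \<times> {j}) 0 (\<lambda>_. coin)"
  let ?q = "if j \<in> J' then p else 1"
  have "R \<times> insert j J = (R \<times> J) \<union> (R \<times> {j})" by auto
  then have Pi: "Pi_pmf (R \<times> insert j J) 0 (\<lambda>_. coin) =
      map_pmf (\<lambda>(f, g) x. if x \<in> R \<times> J then f x else g x) (pair_pmf ?A ?B)"
    using assms(1) insert.hyps Pi_pmf_union[of "R \<times> J" "R \<times> {j}" 0 "\<lambda>_. coin"] by auto
  have "measure_pmf.prob (Pi_pmf (R \<times> insert j J) 0 (\<lambda>_. coin)) {\<xi>. \<forall>j'\<in>insert j J \<inter> J'. ?C j' \<xi>}
    = measure_pmf.prob (pair_pmf ?A ?B) {z. (\<forall>j'\<in>J \<inter> J'. ?C j' (fst z)) \<and> (j \<in> J' \<longrightarrow> ?C j (snd z))}"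
  proof -
    have "(\<forall>j'\<in>insert j J \<inter> J'. ?C j' (\<lambda>x. if x \<in> R \<times> J then f x else g x)) \<longleftrightarrow>
        (\<forall>j'\<in>J \<inter> J'. ?C j' f) \<and> (j \<in> J' \<longrightarrow> ?C j g)" for f g
    proof -
      have "?C j' (\<lambda>x. if x \<in> R \<times> J then f x else g x) \<longleftrightarrow> ?C j' f" if "j' \<in> J" for j'
        using that by simp
      moreover have "?C j (\<lambda>x. if x \<in> R \<times> J then f x else g x) \<longleftrightarrow> ?C j g"
        using insert.hyps by simp
      ultimately show ?thesis by blast
    qed
    then show ?thesis
      unfolding Pi measure_map_pmf vimage_def by (simp add: case_prod_beta)
  qed
  also have "\<dots> \<le> ?q * measure_pmf.prob ?A {\<xi>. \<forall>j'\<in>J \<inter> J'. ?C j' \<xi>}"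
    by (rule prob_pair_le[where P = "\<lambda>x y. j \<in> J' \<longrightarrow> ?C j x"])
      (auto simp: prob_linear_form_column[OF assms(1)] assms(3,4))
  also have "\<dots> \<le> ?q * p ^ card (J \<inter> J')"
    using assms(4) by (intro mult_left_mono insert.IH) auto
  also have "\<dots> = p ^ card (insert j J \<inter> J')" using insert.hyps by simp
  finally show ?case .
qed simp

text \<open>The selected vector does not look at column \<open>i\<close>. Once the other columns are
  revealed it is fixed while column \<open>i\<close> is still fresh, so a vector without
  concentration meets the constraint with probability at most \<open>p\<close>.\<close>

lemma prob_selected_column_le:
  fixes sel :: "('k \<times> 'j \<Rightarrow> real) \<Rightarrow> 'k \<Rightarrow> int" and c :: "('k \<Rightarrow> int) \<Rightarrow> int"
  assumes "finite R" "finite J" "i \<in> J" "0 \<le> p"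
    and sel: "\<And>\<xi> \<xi>'. (\<And>k j. k \<in> R \<Longrightarrow> j \<in> J - {i} \<Longrightarrow> \<xi> (k, j) = \<xi>' (k, j)) \<Longrightarrow> sel \<xi> = sel \<xi>'"
  shows "measure_pmf.prob (Pi_pmf (R \<times> J) 0 (\<lambda>_. coin))
      {\<xi>. (\<forall>z. avg (sel \<xi>) R (iball r) z \<le> p) \<and>
        \<bar>real_of_int (c (sel \<xi>)) + (\<Sum>k\<in>R. real_of_int (sel \<xi> k) * \<xi> (k, i))\<bar> \<le> real_of_int r} \<le> p"
proof -
  let ?C = "\<lambda>W \<xi>. \<bar>real_of_int (c W) + (\<Sum>k\<in>R. real_of_int (W k) * \<xi> (k, i))\<bar> \<le> real_of_int r"
  let ?A = "Pi_pmf (R \<times> (J - {i})) 0 (\<lambda>_. coin)" and ?B = "Pi_pmf (R \<times> {i}) 0 (\<lambda>_. coin)"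
  have "R \<times> J = (R \<times> (J - {i})) \<union> (R \<times> {i})" using assms by auto
  then have Pi: "Pi_pmf (R \<times> J) 0 (\<lambda>_. coin) =
      map_pmf (\<lambda>(f, g) x. if x \<in> R \<times> (J - {i}) then f x else g x) (pair_pmf ?A ?B)"
    using assms Pi_pmf_union[of "R \<times> (J - {i})" "R \<times> {i}" 0 "\<lambda>_. coin"] by auto
  have selm: "sel (\<lambda>x. if x \<in> R \<times> (J - {i}) then f x else g x) = sel f" for f g
    by (rule sel) auto
  have "measure_pmf.prob (Pi_pmf (R \<times> J) 0 (\<lambda>_. coin))
      {\<xi>. (\<forall>z. avg (sel \<xi>) R (iball r) z \<le> p) \<and> ?C (sel \<xi>) \<xi>}
    = measure_pmf.prob (pair_pmf ?A ?B)
      {z. (\<forall>t. avg (sel (fst z)) R (iball r) t \<le> p) \<and> ?C (sel (fst z)) (snd z)}"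
    unfolding Pi measure_map_pmf vimage_def
    by (rule arg_cong[where f = "measure_pmf.prob (pair_pmf ?A ?B)"])
      (auto simp: case_prod_beta selm)
  also have "\<dots> \<le> p * measure_pmf.prob ?A {\<xi>. \<forall>t. avg (sel \<xi>) R (iball r) t \<le> p}"
    by (rule prob_pair_le[where P = "\<lambda>x y. ?C (sel y) x"])
      (auto simp: prob_linear_form_column[OF assms(1)] assms(4))
  also have "\<dots> \<le> p" using assms(4) by (simp add: mult_left_le)
  finally show ?thesis .
qed

section \<open>Vectors orthogonal to all but one column\<close>

lemma exists_orthogonal_to_columns:
  fixes a :: "nat \<Rightarrow> nat \<Rightarrow> real"
  assumes "i < n"
  shows "\<exists>w. (\<forall>k<n. \<bar>w k\<bar> \<le> 1) \<and> (\<exists>k<n. \<bar>w k\<bar> = 1) \<and>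
    (\<forall>j<n. j \<noteq> i \<longrightarrow> (\<Sum>k<n. w k * a k j) = 0)"
proof -
  \<comment> \<open>The rows of \<open>B\<close> are the columns of \<open>a\<close>; the zero row
    at \<open>i\<close> both drops that constraint and makes \<open>B\<close> singular.\<close>
  define B where "B = mat n n (\<lambda>(j, k). if j = i then 0 else a k j)"
  have B: "B \<in> carrier_mat n n" by (simp add: B_def)
  have "transpose_mat B *\<^sub>v unit_vec n i = 0\<^sub>v n"
    using assms by (intro eq_vecI) (auto simp: B_def)
  moreover have "unit_vec n i \<noteq> (0\<^sub>v n :: real vec)" using assms by simp
  ultimately have "det (transpose_mat B) = 0"
    using det_0_iff_vec_prod_zero[of "transpose_mat B" n] B by (metis transpose_carrier_mat unit_vec_carrier)
  then have "det B = 0" using det_transpose[OF B] by simp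
  then obtain v where v: "v \<in> carrier_vec n" "v \<noteq> 0\<^sub>v n" "B *\<^sub>v v = 0\<^sub>v n"
    using det_0_iff_vec_prod_zero[OF B] by auto
  obtain k0 where k0: "k0 < n" "v $ k0 \<noteq> 0"
    using v by (metis carrier_vecD eq_vecI index_zero_vec(1) index_zero_vec(2))
  \<comment> \<open>Dividing by the largest entry makes some coordinate exactly 1 in absolute
    value.\<close>
  define \<mu> where "\<mu> = Max ((\<lambda>k. \<bar>v $ k\<bar>) ` {..<n})"
  have "\<mu> \<in> (\<lambda>k. \<bar>v $ k\<bar>) ` {..<n}" unfolding \<mu>_def using assms by (intro Max_in) auto
  then obtain k1 where k1: "k1 < n" "\<bar>v $ k1\<bar> = \<mu>" by auto
  have le: "\<bar>v $ k\<bar> \<le> \<mu>" if "k < n" for k unfolding \<mu>_def using that by (intro Max_ge) auto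
  have pos: "\<mu> > 0" using le[OF k0(1)] k0(2) by linarith
  have "(\<Sum>k<n. v $ k / \<mu> * a k j) = 0" if "j < n" "j \<noteq> i" for j
  proof -
    have "(B *\<^sub>v v) $ j = (\<Sum>k<n. a k j * v $ k)"
      using that v(1) B by (simp add: B_def scalar_prod_def lessThan_atLeast0)
    then have "(\<Sum>k<n. a k j * v $ k) = 0" using v(3) that by simp
    moreover have "(\<Sum>k<n. v $ k / \<mu> * a k j) = (\<Sum>k<n. a k j * v $ k) / \<mu>"
      by (simp add: sum_divide_distrib mult.commute)
    ultimately show ?thesis by simp
  qed
  then show ?thesis
    using k1 le pos by (intro exI[of _ "\<lambda>k. v $ k / \<mu>"]) (auto simp: divide_le_eq)
qed

section \<open>From a large inverse to an almost orthogonal column\<close>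

lemma eucl_norm_eq: "eucl_norm v = L2_set (\<lambda>k. v $ k) {..<dim_vec v}"
  by (simp add: eucl_norm_def L2_set_def scalar_prod_def power2_eq_square lessThan_atLeast0)

text \<open>A singular matrix has a kernel vector. Otherwise take the image under the inverse of a
  unit vector that nearly attains its norm; the factor 2 avoids having to attain the
  supremum.\<close>

lemma inverse_op_norm_ge_imp_small_image:
  assumes A: "A \<in> carrier_mat n n" and "b > 0" "inverse_op_norm A \<ge> ennreal b"
  shows "\<exists>z\<in>carrier_vec n. z \<noteq> 0\<^sub>v n \<and> b * eucl_norm (A *\<^sub>v z) \<le> 2 * eucl_norm z"
proof (cases "mat_inverse A")
  case None
  have "det A = 0"
    using mat_inverse(1)[OF A None, of "()"] det_non_zero_imp_unit[OF A, of "()"] by blast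
  then obtain v where "v \<in> carrier_vec n" "v \<noteq> 0\<^sub>v n" "A *\<^sub>v v = 0\<^sub>v n"
    using det_0_iff_vec_prod_zero[OF A] by auto
  then show ?thesis by (intro bexI[of _ v]) (auto simp: eucl_norm_eq L2_set_def intro!: sum_nonneg)
next
  case (Some B)
  have B: "A * B = 1\<^sub>m n" "B \<in> carrier_mat n n" using mat_inverse(2)[OF A Some] by auto
  have "ennreal (b / 2) < ennreal b" using assms(2) by (simp add: ennreal_lessI)
  also have "\<dots> \<le> op_norm B" using assms(3) Some by (simp add: inverse_op_norm_def)
  finally obtain x where x: "x \<in> carrier_vec n" "eucl_norm x = 1" "ennreal (b / 2) < ennreal (eucl_norm (B *\<^sub>v x))"
    using B(2) by (auto simp: op_norm_def less_SUP_iff)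
  have big: "b / 2 < eucl_norm (B *\<^sub>v x)" using x(3) assms(2) by (simp add: ennreal_less_iff)
  have Ax: "A *\<^sub>v (B *\<^sub>v x) = x"
    using assoc_mult_mat_vec[OF A B(2) x(1)] B(1) x(1) by simp
  have "B *\<^sub>v x \<noteq> 0\<^sub>v n"
  proof
    assume "B *\<^sub>v x = 0\<^sub>v n"
    then show False using big assms(2) by (simp add: eucl_norm_eq L2_set_def)
  qed
  then show ?thesis
    using big Ax x B(2) by (intro bexI[of _ "B *\<^sub>v x"]) auto
qed

text \<open>Let \<open>i\<close> index a largest entry of a vector \<open>z\<close> with small
  image; this choice precedes \<open>w\<close>. Pairing \<open>A z\<close> with \<open>w\<close>
  kills every column except \<open>i\<close>, and one divides by that entry. One factor
  \<open>n\<close> comes from the pairing, the other from bounding the norm of \<open>z\<close> by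
  \<open>n\<close> times its largest entry.\<close>

lemma inverse_op_norm_ge_imp_column:
  assumes A: "A \<in> carrier_mat n n" and "b > 0" "inverse_op_norm A \<ge> ennreal b"
  shows "\<exists>i<n. \<forall>w. (\<forall>k<n. \<bar>w k\<bar> \<le> 1) \<longrightarrow> (\<forall>j<n. j \<noteq> i \<longrightarrow> (\<Sum>k<n. w k * A $$ (k, j)) = 0) \<longrightarrow>
    b * \<bar>\<Sum>k<n. w k * A $$ (k, i)\<bar> \<le> 2 * real n ^ 2"
proof -
  obtain z where z: "z \<in> carrier_vec n" "z \<noteq> 0\<^sub>v n" "b * eucl_norm (A *\<^sub>v z) \<le> 2 * eucl_norm z"
    using inverse_op_norm_ge_imp_small_image[OF assms] by auto
  obtain k0 where k0: "k0 < n" "z $ k0 \<noteq> 0"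
    using z by (metis carrier_vecD eq_vecI index_zero_vec(1) index_zero_vec(2))
  define \<mu> where "\<mu> = Max ((\<lambda>k. \<bar>z $ k\<bar>) ` {..<n})"
  have "\<mu> \<in> (\<lambda>k. \<bar>z $ k\<bar>) ` {..<n}" unfolding \<mu>_def using k0 by (intro Max_in) auto
  then obtain i where i: "i < n" "\<bar>z $ i\<bar> = \<mu>" by auto
  have le: "\<bar>z $ k\<bar> \<le> \<mu>" if "k < n" for k unfolding \<mu>_def using that by (intro Max_ge) auto
  have pos: "\<mu> > 0" using le[OF k0(1)] k0(2) by linarith
  have Az: "(A *\<^sub>v z) $ k = (\<Sum>j<n. A $$ (k, j) * z $ j)" if "k < n" for k
    using that z(1) A by (simp add: scalar_prod_def lessThan_atLeast0)
  have "b * \<bar>\<Sum>k<n. w k * A $$ (k, i)\<bar> \<le> 2 * real n ^ 2"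
    if w: "\<forall>k<n. \<bar>w k\<bar> \<le> 1" "\<forall>j<n. j \<noteq> i \<longrightarrow> (\<Sum>k<n. w k * A $$ (k, j)) = 0" for w
  proof -
    let ?c = "\<Sum>k<n. w k * A $$ (k, i)"
    have "(\<Sum>k<n. w k * (A *\<^sub>v z) $ k) = (\<Sum>k<n. \<Sum>j<n. w k * A $$ (k, j) * z $ j)"
      by (intro sum.cong) (auto simp: Az sum_distrib_left mult.assoc)
    also have "\<dots> = (\<Sum>j<n. (\<Sum>k<n. w k * A $$ (k, j)) * z $ j)"
      by (subst sum.swap) (simp add: sum_distrib_right)
    also have "\<dots> = (\<Sum>j<n. if j = i then ?c * z $ i else 0)"
      by (intro sum.cong) (use w(2) in auto)
    also have "\<dots> = ?c * z $ i" using i by simp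
    finally have "\<bar>?c\<bar> * \<mu> = \<bar>\<Sum>k<n. w k * (A *\<^sub>v z) $ k\<bar>" using i by (simp add: abs_mult)
    also have "\<dots> \<le> (\<Sum>k<n. \<bar>w k * (A *\<^sub>v z) $ k\<bar>)" by (rule sum_abs)
    also have "\<dots> \<le> (\<Sum>k<n. eucl_norm (A *\<^sub>v z))"
    proof (rule sum_mono)
      fix k assume "k \<in> {..<n}"
      then have k: "k < n" by simp
      have "\<bar>w k * (A *\<^sub>v z) $ k\<bar> \<le> 1 * \<bar>(A *\<^sub>v z) $ k\<bar>"
        unfolding abs_mult using w(1) k by (intro mult_right_mono) auto
      also have "\<dots> \<le> eucl_norm (A *\<^sub>v z)"
        using member_le_L2_set[of "{..<n}" k "\<lambda>k. \<bar>(A *\<^sub>v z) $ k\<bar>"] A k by (simp add: eucl_norm_eq L2_set_def)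
      finally show "\<bar>w k * (A *\<^sub>v z) $ k\<bar> \<le> eucl_norm (A *\<^sub>v z)" .
    qed
    also have "\<dots> = real n * eucl_norm (A *\<^sub>v z)" by simp
    finally have 1: "b * (\<bar>?c\<bar> * \<mu>) \<le> real n * (b * eucl_norm (A *\<^sub>v z))"
      using assms(2) by (simp add: mult_left_mono mult.left_commute)
    have "eucl_norm z \<le> (\<Sum>k<n. \<bar>z $ k\<bar>)"
      using L2_set_le_sum_abs[of "\<lambda>k. z $ k" "{..<n}"] z(1) by (simp add: eucl_norm_eq)
    also have "\<dots> \<le> (\<Sum>k<n. \<mu>)" by (intro sum_mono le) simp
    finally have "eucl_norm z \<le> real n * \<mu>" by simp
    then have "real n * (b * eucl_norm (A *\<^sub>v z)) \<le> real n * (2 * (real n * \<mu>))"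
      using z(3) by (intro mult_left_mono) auto
    with 1 have "(b * \<bar>?c\<bar>) * \<mu> \<le> (2 * real n ^ 2) * \<mu>"
      by (simp add: power2_eq_square mult_ac)
    then show ?thesis using pos by simp
  qed
  then show ?thesis using i by blast
qed

text \<open>Only the columns other than \<open>i\<close> enter, so a vector can be selected without
  looking at column \<open>i\<close>. A coordinate of full size \<open>T\<close> is demanded so that
  \<open>avg_iball_le_half\<close> applies to it.\<close>

definition rounded_orthogonal :: "nat \<Rightarrow> int \<Rightarrow> nat \<Rightarrow> (nat \<Rightarrow> nat \<Rightarrow> real) \<Rightarrow> (nat \<Rightarrow> int) \<Rightarrow> bool" where
  "rounded_orthogonal n T i a W \<longleftrightarrow> (\<forall>k<n. \<bar>W k\<bar> \<le> T) \<and> (\<exists>k<n. \<bar>W k\<bar> = T) \<and>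
    (\<exists>w. (\<forall>k<n. \<bar>w k\<bar> \<le> 1) \<and> (\<forall>j<n. j \<noteq> i \<longrightarrow> (\<Sum>k<n. w k * a k j) = 0) \<and>
      (\<forall>k<n. \<bar>real_of_int (W k) - real_of_int T * w k\<bar> \<le> 1))"

lemma exists_rounded_orthogonal:
  assumes "i < n" "T > 0"
  shows "\<exists>W. rounded_orthogonal n T i a W"
proof -
  obtain w where w: "\<forall>k<n. \<bar>w k\<bar> \<le> 1" "\<exists>k<n. \<bar>w k\<bar> = 1"
    "\<forall>j<n. j \<noteq> i \<longrightarrow> (\<Sum>k<n. w k * a k j) = 0"
    using exists_orthogonal_to_columns[OF assms(1), of a] by blast
  let ?W = "\<lambda>k. \<lfloor>real_of_int T * w k\<rfloor>"
  have "\<bar>?W k\<bar> \<le> T" if "k < n" for k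
  proof -
    have "\<bar>real_of_int T * w k\<bar> \<le> real_of_int T * 1"
      unfolding abs_mult using w(1) that assms(2) by (intro mult_mono) auto
    then have "- real_of_int T \<le> real_of_int T * w k" "real_of_int T * w k \<le> real_of_int T" by auto
    then have "- T \<le> ?W k" "?W k \<le> T" by (simp_all add: le_floor_iff floor_le_iff)
    then show ?thesis by (simp add: abs_le_iff)
  qed
  moreover have "\<exists>k<n. \<bar>?W k\<bar> = T"
  proof -
    obtain k where k: "k < n" "\<bar>w k\<bar> = 1" using w(2) by blast
    \<comment> \<open>At such a coordinate the floor is exact, since \<open>T\<close> is an
      integer.\<close>
    then have "w k = 1 \<or> w k = - 1" by auto
    then have "\<bar>?W k\<bar> = T" using assms(2) by auto
    then show ?thesis using k by blast
  qed
  moreover have "\<bar>real_of_int (?W k) - real_of_int T * w k\<bar> \<le> 1" for k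
    by linarith
  ultimately show ?thesis using w unfolding rounded_orthogonal_def by (intro exI[of _ ?W]) blast
qed

lemma rounded_orthogonal_column_le:
  assumes "\<And>k. k < n \<Longrightarrow> \<bar>real_of_int (W k) - real_of_int T * w k\<bar> \<le> 1" "\<And>k. k < n \<Longrightarrow> \<bar>a k\<bar> \<le> K"
    "T > 0"
  shows "\<bar>\<Sum>k<n. real_of_int (W k) * a k\<bar> \<le> real_of_int T * \<bar>\<Sum>k<n. w k * a k\<bar> + real n * K"
proof -
  have "(\<Sum>k<n. real_of_int (W k) * a k) = real_of_int T * (\<Sum>k<n. w k * a k) + (\<Sum>k<n. (real_of_int (W k) - real_of_int T * w k) * a k)"
    by (simp add: sum_distrib_left sum.distrib[symmetric] algebra_simps)
  then have "\<bar>\<Sum>k<n. real_of_int (W k) * a k\<bar> \<le> \<bar>real_of_int T * (\<Sum>k<n. w k * a k)\<bar> + \<bar>\<Sum>k<n. (real_of_int (W k) - real_of_int T * w k) * a k\<bar>"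
    by simp
  also have "\<bar>\<Sum>k<n. (real_of_int (W k) - real_of_int T * w k) * a k\<bar> \<le> (\<Sum>k<n. \<bar>(real_of_int (W k) - real_of_int T * w k) * a k\<bar>)"
    by (rule sum_abs)
  also have "\<dots> \<le> (\<Sum>k<n. 1 * K)"
    unfolding abs_mult by (intro sum_mono mult_mono assms) auto
  finally show ?thesis using assms(3) by (simp add: abs_mult)
qed

text \<open>Rounding costs at most \<open>n * K\<close> in each column. The exact vector contributes
  nothing to the columns other than \<open>i\<close>, and to column \<open>i\<close> at most
  \<open>2 * n^2 * T / b\<close>, which is at most another \<open>n * K\<close>.\<close>

lemma rounded_orthogonal_columns_le:
  assumes "rounded_orthogonal n T i a W" "T > 0" "b > 0"
    and bd: "\<And>k j. k < n \<Longrightarrow> j < n \<Longrightarrow> \<bar>a k j\<bar> \<le> K"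
    and i: "i < n" "\<forall>w. (\<forall>k<n. \<bar>w k\<bar> \<le> 1) \<longrightarrow> (\<forall>j<n. j \<noteq> i \<longrightarrow> (\<Sum>k<n. w k * a k j) = 0) \<longrightarrow>
      b * \<bar>\<Sum>k<n. w k * a k i\<bar> \<le> 2 * real n ^ 2"
    and T: "2 * real n ^ 2 * real_of_int T \<le> b * (real n * K)"
  shows "\<And>j. j < n \<Longrightarrow> j \<noteq> i \<Longrightarrow> \<bar>\<Sum>k<n. real_of_int (W k) * a k j\<bar> \<le> real n * K"
    and "\<bar>\<Sum>k<n. real_of_int (W k) * a k i\<bar> \<le> 2 * (real n * K)"
proof -
  obtain w where w: "\<forall>k<n. \<bar>w k\<bar> \<le> 1" "\<forall>j<n. j \<noteq> i \<longrightarrow> (\<Sum>k<n. w k * a k j) = 0"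
    "\<And>k. k < n \<Longrightarrow> \<bar>real_of_int (W k) - real_of_int T * w k\<bar> \<le> 1"
    using assms(1) unfolding rounded_orthogonal_def by blast
  have le: "\<bar>\<Sum>k<n. real_of_int (W k) * a k j\<bar> \<le> real_of_int T * \<bar>\<Sum>k<n. w k * a k j\<bar> + real n * K" if "j < n" for j
    by (rule rounded_orthogonal_column_le) (use w(3) bd that assms(2) in auto)
  show "\<bar>\<Sum>k<n. real_of_int (W k) * a k j\<bar> \<le> real n * K" if "j < n" "j \<noteq> i" for j
    using le[OF that(1)] w(2) that by simp
  have "b * (real_of_int T * \<bar>\<Sum>k<n. w k * a k i\<bar>) = real_of_int T * (b * \<bar>\<Sum>k<n. w k * a k i\<bar>)"
    by simp
  also have "\<dots> \<le> real_of_int T * (2 * real n ^ 2)"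
    using i(2) w assms(2) by (intro mult_left_mono) auto
  also have "\<dots> \<le> b * (real n * K)" using T by (simp add: mult_ac)
  finally have "real_of_int T * \<bar>\<Sum>k<n. w k * a k i\<bar> \<le> real n * K" using assms(3) by simp
  then show "\<bar>\<Sum>k<n. real_of_int (W k) * a k i\<bar> \<le> 2 * (real n * K)" using le[OF i(1)] by linarith
qed

lemma rounded_orthogonal_cong:
  assumes "\<And>k j. k < n \<Longrightarrow> j < n \<Longrightarrow> j \<noteq> i \<Longrightarrow> a k j = a' k j"
  shows "rounded_orthogonal n T i a W \<longleftrightarrow> rounded_orthogonal n T i a' W"
proof -
  have "(\<Sum>k<n. w k * a k j) = (\<Sum>k<n. w k * a' k j)" if "j < n" "j \<noteq> i" for w j
    by (rule sum.cong) (use assms that in auto)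
  then show ?thesis unfolding rounded_orthogonal_def by (simp cong: conj_cong)
qed

section \<open>Covering rich vectors\<close>

text \<open>A list of (index, value) pairs records the coordinates in the greedily chosen set; it determines
  the level set and hence the net for all other coordinates.\<close>

definition net :: "int \<Rightarrow> nat \<Rightarrow> (nat \<times> int) list \<Rightarrow> int set" where
  "net h m l = (let W = the \<circ> map_of l; I = fst ` set l in
    SOME N. finite N \<and> N \<noteq> {} \<and> real (card N) \<le> 1 + 2 / (real m * corr h W I 0) \<and>
      (\<forall>v. (1 - 1 / (2 * real m ^ 2)) * corr h W I 0 \<le> corr h W I (2 * v) \<longrightarrow> (\<exists>y\<in>N. \<bar>v - y\<bar> \<le> h)))"

definition list_corr :: "int \<Rightarrow> (nat \<times> int) list \<Rightarrow> int \<Rightarrow> real" where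
  "list_corr h l = corr h (the \<circ> map_of l) (fst ` set l)"

lemma net_props:
  assumes "h > 0" "m > 0" "list_corr h l 0 > 0"
  shows "finite (net h m l)" "net h m l \<noteq> {}"
    "real (card (net h m l)) \<le> 1 + 2 / (real m * list_corr h l 0)"
    "\<And>v. (1 - 1 / (2 * real m ^ 2)) * list_corr h l 0 \<le> list_corr h l (2 * v) \<Longrightarrow> \<exists>y\<in>net h m l. \<bar>v - y\<bar> \<le> h"
proof -
  have "finite (net h m l) \<and> net h m l \<noteq> {} \<and> real (card (net h m l)) \<le> 1 + 2 / (real m * list_corr h l 0) \<and>
    (\<forall>v. (1 - 1 / (2 * real m ^ 2)) * list_corr h l 0 \<le> list_corr h l (2 * v) \<longrightarrow> (\<exists>y\<in>net h m l. \<bar>v - y\<bar> \<le> h))"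
    unfolding net_def list_corr_def Let_def
    by (rule someI_ex[OF level_set_net]) (use assms in \<open>auto simp: list_corr_def\<close>)
  then show "finite (net h m l)" "net h m l \<noteq> {}"
    "real (card (net h m l)) \<le> 1 + 2 / (real m * list_corr h l 0)"
    "\<And>v. (1 - 1 / (2 * real m ^ 2)) * list_corr h l 0 \<le> list_corr h l (2 * v) \<Longrightarrow> \<exists>y\<in>net h m l. \<bar>v - y\<bar> \<le> h"
    by blast+
qed

definition cand :: "int \<Rightarrow> nat \<Rightarrow> (nat \<times> int) list \<Rightarrow> nat \<Rightarrow> int set" where
  "cand h m l k = (case map_of l k of Some v \<Rightarrow> {v} | None \<Rightarrow> net h m l)"

text \<open>The list records the greedy set with its values. Each recorded coordinate costs a factor
  \<open>1 - 1 / (4 * m^2)\<close> while the autocorrelation stays above \<open>\<gamma>\<close>, so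
  there are at most \<open>s\<close> of them. All others lie in the level set, hence near the
  net.\<close>

lemma exists_code:
  assumes "finite H" "h > 0" "m > 0" "\<And>k. k \<in> H \<Longrightarrow> \<bar>W k\<bar> \<le> T"
    and "\<gamma> > 0" "\<gamma> \<le> corr h W H 0" "(1 - 1 / (4 * real m ^ 2)) ^ Suc s < \<gamma>"
  shows "\<exists>l. length l \<le> s \<and> set l \<subseteq> H \<times> {-T..T} \<and> corr h W H 0 \<le> list_corr h l 0 \<and> list_corr h l 0 \<le> 1 \<and>
    (\<forall>k\<in>H. \<exists>v\<in>cand h m l k. \<bar>W k - v\<bar> \<le> h)"
proof -
  define \<epsilon> where "\<epsilon> = 1 / (2 * real m ^ 2)"
  define x where "x = real m ^ 2"
  have "x \<ge> 1" using assms(3) by (simp add: x_def one_le_power)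
  then have \<epsilon>: "0 < \<epsilon>" "\<epsilon> < 2" "\<epsilon> / 2 = 1 / (4 * real m ^ 2)"
    unfolding \<epsilon>_def x_def[symmetric] by (auto simp: divide_simps)
  obtain I where I: "I \<subseteq> H" "corr h W I 0 \<le> (1 - \<epsilon> / 2) ^ card I"
    "\<forall>i\<in>H - I. (1 - \<epsilon>) * corr h W I 0 \<le> corr h W I (2 * W i)"
    using greedy_subset[OF assms(1,2) \<epsilon>(1,2), of W] by blast
  have fin: "finite I" using I(1) assms(1) finite_subset by auto
  define l where "l = map (\<lambda>i. (i, W i)) (sorted_list_of_set I)"
  have l: "set l = (\<lambda>i. (i, W i)) ` I" "length l = card I" "fst ` set l = I"
    using fin by (auto simp: l_def image_image)
  have map_l: "map_of l k = (if k \<in> I then Some (W k) else None)" for k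
    using fin by (simp add: l_def map_of_map_restrict restrict_map_def)
  have lc: "list_corr h l = corr h W I"
    unfolding list_corr_def l(3) by (rule corr_cong[OF fin]) (simp add: map_l)
  have mono: "corr h W H 0 \<le> corr h W I 0" using corr_mono[OF assms(1) I(1) assms(2)] .
  have "card I \<le> s"
  proof (rule ccontr)
    assume "\<not> ?thesis"
    then have "Suc s \<le> card I" by simp
    then have "(1 - \<epsilon> / 2) ^ card I \<le> (1 - \<epsilon> / 2) ^ Suc s"
      by (intro power_decreasing) (assumption | (use \<epsilon>(1,2) in linarith))+
    then show False using I(2) mono assms(6,7) unfolding \<epsilon>(3) by linarith
  qed
  moreover have "set l \<subseteq> H \<times> {-T..T}" using I(1) assms(4) by (force simp: l(1) abs_le_iff)
  moreover have "\<exists>v\<in>cand h m l k. \<bar>W k - v\<bar> \<le> h" if "k \<in> H" for k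
  proof (cases "k \<in> I")
    case True
    then show ?thesis using assms(2) by (simp add: cand_def map_l)
  next
    case False
    then have "(1 - 1 / (2 * real m ^ 2)) * list_corr h l 0 \<le> list_corr h l (2 * W k)"
      using I(3) that unfolding lc \<epsilon>_def by blast
    moreover have "list_corr h l 0 > 0" using mono assms(5,6) unfolding lc by linarith
    ultimately have "\<exists>y\<in>net h m l. \<bar>W k - y\<bar> \<le> h" using net_props(4)[OF assms(2,3)] by blast
    then show ?thesis using False by (simp add: cand_def map_l)
  qed
  ultimately show ?thesis using mono corr_le_1[OF fin assms(2), of W] l(2) lc by (intro exI[of _ l]) auto
qed

section \<open>Counting candidates against their probability\<close>

definition cands :: "nat \<Rightarrow> int \<Rightarrow> nat \<Rightarrow> (nat \<times> int) list \<Rightarrow> (nat \<times> int) list \<Rightarrow> (nat \<Rightarrow> int) set" where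
  "cands n h m l1 l2 = (\<Pi>\<^sub>E k\<in>{..<n}. if k < n div 2 then cand h m l1 k else cand h m l2 k)"

text \<open>\<open>\<kappa>\<close> is the growth of the product of autocorrelations allowed between
  one scale and the next. The bound 1/2 serves the case of nets with a single point.\<close>

definition conc_bound :: "real \<Rightarrow> int \<Rightarrow> (nat \<times> int) list \<Rightarrow> (nat \<times> int) list \<Rightarrow> real" where
  "conc_bound \<kappa> h l1 l2 = min (1/2) (2 * sqrt (\<kappa> * (list_corr h l1 0 * list_corr h l2 0)))"

lemma finite_cand:
  assumes "h > 0" "m > 0" "list_corr h l 0 > 0"
  shows "finite (cand h m l k)" "card (cand h m l k) \<le> card (net h m l)"
  using net_props[OF assms] card_gt_0_iff[of "net h m l"] by (auto simp: cand_def Suc_le_eq split: option.split)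

text \<open>The larger half has \<open>(n + 1) div 2\<close> coordinates; using this exponent for
  both halves lets the net sizes be multiplied.\<close>

lemma card_cands_le:
  assumes "h > 0" "m > 0" "list_corr h l1 0 > 0" "list_corr h l2 0 > 0"
  shows "finite (cands n h m l1 l2)"
    "card (cands n h m l1 l2) \<le> (card (net h m l1) * card (net h m l2)) ^ ((n + 1) div 2)"
proof -
  let ?r1 = "card (net h m l1)" and ?r2 = "card (net h m l2)"
  show "finite (cands n h m l1 l2)"
    unfolding cands_def using finite_cand assms by (intro finite_PiE) auto
  have r: "?r1 \<ge> 1" "?r2 \<ge> 1"
    using net_props(1,2)[OF assms(1,2,3)] net_props(1,2)[OF assms(1,2,4)] by (auto simp: Suc_le_eq card_gt_0_iff)
  have split: "{..<n} = {..<n div 2} \<union> {n div 2..<n}" by auto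
  have "card (cands n h m l1 l2) = (\<Prod>k<n. card (if k < n div 2 then cand h m l1 k else cand h m l2 k))"
    unfolding cands_def by (simp add: card_PiE)
  also have "\<dots> \<le> (\<Prod>k<n. if k < n div 2 then ?r1 else ?r2)"
    using finite_cand(2) assms by (intro prod_mono) auto
  also have "\<dots> = (\<Prod>k\<in>{..<n div 2}. ?r1) * (\<Prod>k\<in>{n div 2..<n}. ?r2)"
    unfolding split by (subst prod.union_disjoint) (auto intro!: arg_cong2[where f = "(*)"] prod.cong)
  also have "\<dots> = ?r1 ^ (n div 2) * ?r2 ^ (n - n div 2)" by simp
  also have "\<dots> \<le> ?r1 ^ ((n + 1) div 2) * ?r2 ^ ((n + 1) div 2)"
    using r by (intro mult_mono power_increasing) auto
  finally show "card (cands n h m l1 l2) \<le> (?r1 * ?r2) ^ ((n + 1) div 2)" by (simp add: power_mult_distrib)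
qed

text \<open>Unless the net is a single point, \<open>r \<le> 2 * (r - 1)\<close> absorbs the
  additive 1, and the saving of a factor \<open>m\<close> over \<open>1 / q\<close> becomes
  visible.\<close>

lemma net_size_dichotomy:
  fixes q m :: real and r :: nat
  assumes "r \<ge> 1" "0 < q" "q \<le> 1" "m \<ge> 4" "real r \<le> 1 + 2 / (m * q)"
  shows "real r * q \<le> 1" "r = 1 \<or> real r * q \<le> 4 / m"
proof -
  have *: "real r * q \<le> 4 / m" if "r \<noteq> 1"
  proof -
    have "real r \<ge> 2" using that assms(1) by linarith
    then have "real r \<le> 2 * (real r - 1)" by simp
    also have "\<dots> \<le> 4 / (m * q)" using assms(5) by simp
    finally show ?thesis using assms by (simp add: field_simps)
  qed
  show "real r * q \<le> 1"
  proof (cases "r = 1")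
    case False
    have "4 / m \<le> 1" using assms by simp
    then show ?thesis using *[OF False] by linarith
  qed (use assms in auto)
  show "r = 1 \<or> real r * q \<le> 4 / m" using * by blast
qed

text \<open>Each pair of coordinates, one from each half, has at most \<open>r1 * r2\<close> choices
  and is matched with two columns, which cost \<open>p^2\<close>. If both nets are single points,
  \<open>p \<le> 1/2\<close> makes the product at most 1/4; otherwise it is at most
  \<open>16 * \<kappa> / m\<close>, again at most 1/4.\<close>

lemma card_cands_times_power_le:
  assumes h: "h > 0" and m: "m \<ge> 4" and n: "n \<ge> 1" and "\<kappa> \<ge> 0" "64 * \<kappa> \<le> real m" "\<gamma> > 0"
    and q1: "0 < list_corr h l1 0" "list_corr h l1 0 \<le> 1"
    and q2: "0 < list_corr h l2 0" "list_corr h l2 0 \<le> 1"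
    and \<gamma>: "\<gamma> \<le> list_corr h l1 0 * list_corr h l2 0"
  shows "real (card (cands n h m l1 l2)) * conc_bound \<kappa> h l1 l2 ^ (n - 1)
    \<le> 1 / \<gamma> * (1 / 4) ^ ((n + 1) div 2 - 1)"
proof -
  define r1 where "r1 = card (net h m l1)"
  define r2 where "r2 = card (net h m l2)"
  define a where "a = list_corr h l1 0"
  define b where "b = list_corr h l2 0"
  define p where "p = conc_bound \<kappa> h l1 l2"
  define N where "N = (n + 1) div 2"
  have m0: "m > 0" using m by simp
  have ab: "0 < a" "a \<le> 1" "0 < b" "b \<le> 1" "\<gamma> \<le> a * b" using q1 q2 \<gamma> by (auto simp: a_def b_def)
  have r: "r1 \<ge> 1" "r2 \<ge> 1"
    using net_props(1,2)[OF h m0 q1(1)] net_props(1,2)[OF h m0 q2(1)]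
    by (auto simp: Suc_le_eq card_gt_0_iff r1_def r2_def)
  have d1: "real r1 * a \<le> 1" "r1 = 1 \<or> real r1 * a \<le> 4 / real m"
    using net_size_dichotomy[OF r(1) ab(1,2), of "real m"] net_props(3)[OF h m0 q1(1)] m by (auto simp: a_def r1_def)
  have d2: "real r2 * b \<le> 1" "r2 = 1 \<or> real r2 * b \<le> 4 / real m"
    using net_size_dichotomy[OF r(2) ab(3,4), of "real m"] net_props(3)[OF h m0 q2(1)] m by (auto simp: b_def r2_def)
  have abpos: "0 < a * b" using ab by simp
  have p: "0 \<le> p" "p \<le> 1" "p ^ 2 \<le> 1 / 4" "p ^ 2 \<le> 4 * \<kappa> * (a * b)"
  proof -
    have p0: "0 \<le> p" using abpos assms(4) by (simp add: p_def conc_bound_def a_def b_def)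
    have p1: "p \<le> 1 / 2" "p \<le> 2 * sqrt (\<kappa> * (a * b))" by (auto simp: p_def conc_bound_def a_def b_def)
    show "0 \<le> p" "p \<le> 1" using p0 p1 by auto
    show "p ^ 2 \<le> 1 / 4" using power_mono[OF p1(1) p0, of 2] by (simp add: power2_eq_square)
    show "p ^ 2 \<le> 4 * \<kappa> * (a * b)"
      using power_mono[OF p1(2) p0, of 2] abpos assms(4) by (simp add: power_mult_distrib)
  qed
  have rr: "(real r1 * a) * (real r2 * b) \<le> 1" using mult_le_one[OF d1(1) _ d2(1)] ab by simp
  have rr\<gamma>: "real r1 * real r2 \<le> 1 / \<gamma>"
  proof -
    have "real r1 * real r2 * \<gamma> \<le> real r1 * real r2 * (a * b)" using ab by (intro mult_left_mono) auto
    also have "\<dots> \<le> 1" using rr by (simp add: mult_ac)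
    finally show ?thesis using assms(6) by (simp add: field_simps)
  qed
  have key: "real r1 * real r2 * p ^ 2 \<le> 1 / 4"
  proof (cases "r1 = 1 \<and> r2 = 1")
    case True
    then show ?thesis using p by simp
  next
    case False
    have "(real r1 * a) * (real r2 * b) \<le> 4 / real m"
    proof (cases "r1 = 1")
      case True
      then have "real r2 * b \<le> 4 / real m" using False d2 by auto
      then have "(real r1 * a) * (real r2 * b) \<le> 1 * (4 / real m)" using d1 ab by (intro mult_mono) auto
      then show ?thesis by simp
    next
      case False
      then have "real r1 * a \<le> 4 / real m" using d1 by auto
      then have "(real r1 * a) * (real r2 * b) \<le> (4 / real m) * 1" using d2 ab by (intro mult_mono) auto
      then show ?thesis by simp
    qed
    then have 1: "(real r1 * a) * (real r2 * b) * (4 * \<kappa>) \<le> (4 / real m) * (4 * \<kappa>)"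
      using assms(4) by (intro mult_right_mono) auto
    have "real r1 * real r2 * p ^ 2 \<le> real r1 * real r2 * (4 * \<kappa> * (a * b))"
      using p by (intro mult_left_mono) auto
    also have "\<dots> \<le> (4 / real m) * (4 * \<kappa>)" using 1 by (simp add: mult_ac)
    also have "\<dots> \<le> 1 / 4" using assms(5) m by (simp add: field_simps)
    finally show ?thesis .
  qed
  \<comment> \<open>Only \<open>n - 1\<close> columns are constrained, which gives
    \<open>N - 1\<close> matched pairs; the leftover factor \<open>r1 * r2\<close> costs
    \<open>1 / \<gamma>\<close>.\<close>
  have N1: "N = Suc (N - 1)" "2 * (N - 1) \<le> n - 1" using n by (auto simp: N_def)
  have "real (card (cands n h m l1 l2)) * p ^ (n - 1) \<le> real ((r1 * r2) ^ N) * p ^ (2 * (N - 1))"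
  proof (rule mult_mono)
    show "real (card (cands n h m l1 l2)) \<le> real ((r1 * r2) ^ N)"
      using card_cands_le(2)[OF h m0 q1(1) q2(1), of n] unfolding r1_def r2_def N_def of_nat_le_iff .
    show "p ^ (n - 1) \<le> p ^ (2 * (N - 1))" using p N1 by (intro power_decreasing) auto
  qed (use p in auto)
  also have "\<dots> = (real r1 * real r2) ^ N * (p ^ 2) ^ (N - 1)"
    by (simp add: power_mult[symmetric] power_mult_distrib)
  also have "\<dots> = (real r1 * real r2) * (real r1 * real r2 * p ^ 2) ^ (N - 1)"
    by (subst N1(1)) (simp add: power_mult_distrib mult_ac del: power_mult)
  also have "\<dots> \<le> 1 / \<gamma> * (1 / 4) ^ (N - 1)"
    using rr\<gamma> key assms(6) p by (intro mult_mono power_mono) auto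
  finally show ?thesis by (simp add: p_def N_def)
qed

text \<open>Otherwise \<open>F\<close>, starting from \<open>\<gamma>\<close>, would grow by more
  than \<open>\<kappa>\<close> at every step and exceed 1 at \<open>J\<close>.\<close>

lemma scale_pigeonhole:
  fixes F :: "nat \<Rightarrow> real"
  assumes "\<gamma> > 0" "\<gamma> \<le> F 0" "F J \<le> 1" "1 < \<kappa> ^ J * \<gamma>" "\<kappa> \<ge> 1"
  shows "\<exists>j<J. F (Suc j) \<le> \<kappa> * F j \<and> \<gamma> \<le> F j"
proof (rule ccontr)
  assume no: "\<not> ?thesis"
  have "\<kappa> ^ j * \<gamma> \<le> F j" if "j \<le> J" for j
    using that
  proof (induction j)
    case (Suc j)
    then have IH: "\<kappa> ^ j * \<gamma> \<le> F j" by simp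
    have "1 * \<gamma> \<le> \<kappa> ^ j * \<gamma>" using assms by (intro mult_right_mono) auto
    then have "\<gamma> \<le> F j" using IH by simp
    then have "\<kappa> * F j < F (Suc j)" using no Suc.prems by (meson Suc_le_lessD not_le)
    moreover have "\<kappa> * (\<kappa> ^ j * \<gamma>) \<le> \<kappa> * F j" using IH assms by (intro mult_left_mono) auto
    ultimately show ?case by (simp add: mult_ac)
  qed (use assms in simp)
  from this[of J] show False using assms by simp
qed

text \<open>Rounding at scale \<open>h j\<close> enlarges the radius \<open>rr j\<close> to
  \<open>rr j + h j * n\<close>, which scale \<open>h (Suc j)\<close> accommodates. The pigeonhole
  picks \<open>j\<close> such that passing to that scale costs at most \<open>\<kappa>\<close>, so
  the rounded vector is controlled by its own code at scale \<open>h j\<close>.\<close>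

lemma rich_vector_covered:
  fixes h rr :: "nat \<Rightarrow> int"
  assumes WT: "\<And>k. k < n \<Longrightarrow> \<bar>W k\<bar> \<le> T" "\<exists>k<n. \<bar>W k\<bar> = T"
    and rich: "\<delta> < avg W {..<n} (iball r0) z0" "\<delta> > 0"
    and h: "2 * r0 \<le> h 0" "\<And>j. j \<le> J \<Longrightarrow> h j > 0" "\<And>j. j < J \<Longrightarrow> 2 * (rr j + h j * int n) \<le> h (Suc j)"
      "\<And>j. j < J \<Longrightarrow> rr j + h j * int n < T"
    and \<kappa>: "\<kappa> \<ge> 1" "1 < \<kappa> ^ J * (\<delta> ^ 2 / 4)" and m: "m > 0"
    and s: "(1 - 1 / (4 * real m ^ 2)) ^ Suc s < \<delta> ^ 2 / 4"
  shows "\<exists>j<J. \<exists>l1 l2. length l1 \<le> s \<and> length l2 \<le> s \<and> set l1 \<subseteq> {..<n} \<times> {-T..T} \<and> set l2 \<subseteq> {..<n} \<times> {-T..T} \<and>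
    list_corr (h j) l1 0 \<le> 1 \<and> list_corr (h j) l2 0 \<le> 1 \<and> 0 < list_corr (h j) l1 0 \<and> 0 < list_corr (h j) l2 0 \<and>
    \<delta> ^ 2 / 4 \<le> list_corr (h j) l1 0 * list_corr (h j) l2 0 \<and>
    (\<exists>W'\<in>cands n (h j) m l1 l2. (\<forall>k<n. \<bar>W k - W' k\<bar> \<le> h j) \<and>
      (\<forall>z. avg W' {..<n} (iball (rr j)) z \<le> conc_bound \<kappa> (h j) l1 l2))"
proof -
  define \<gamma> where "\<gamma> = \<delta> ^ 2 / 4"
  define H1 where "H1 = {..<n div 2}"
  define H2 where "H2 = {n div 2..<n}"
  have H: "finite H1" "finite H2" "H1 \<inter> H2 = {}" "H1 \<union> H2 = {..<n}" by (auto simp: H1_def H2_def)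
  define F where "F j = corr (h j) W H1 0 * corr (h j) W H2 0" for j
  have conc: "avg W {..<n} (iball r) z \<le> 2 * sqrt (F j)" if "j \<le> J" "2 * r \<le> h j" for r z j
    unfolding F_def H(4)[symmetric] by (rule avg_iball_le_corr[OF H(1-3)]) (use h that in auto)
  have \<gamma>0: "\<gamma> > 0" using rich by (simp add: \<gamma>_def)
  have F01: "0 \<le> F j" "F j \<le> 1" if "j \<le> J" for j
    unfolding F_def using corr_nonneg corr_le_1 H h(2)[OF that] by (auto intro!: mult_le_one mult_nonneg_nonneg)
  have "\<delta> \<le> 2 * sqrt (F 0)" using conc[of 0 r0 z0] rich h by simp
  then have "\<delta> ^ 2 \<le> (2 * sqrt (F 0)) ^ 2" using rich by (intro power_mono) auto
  then have F0: "\<gamma> \<le> F 0" using F01[of 0] by (simp add: \<gamma>_def power_mult_distrib)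
  obtain j where j: "j < J" "F (Suc j) \<le> \<kappa> * F j" "\<gamma> \<le> F j"
    using scale_pigeonhole[of \<gamma> F J \<kappa>] \<gamma>0 F0 F01[of J] \<kappa> by (auto simp: \<gamma>_def)
  have hj: "h j > 0" using h(2) j(1) by simp
  have c: "0 \<le> corr (h j) W H1 0" "0 \<le> corr (h j) W H2 0" "corr (h j) W H1 0 \<le> 1" "corr (h j) W H2 0 \<le> 1"
    using corr_nonneg corr_le_1 H hj by auto
  have "F j \<le> corr (h j) W H1 0" "F j \<le> corr (h j) W H2 0"
    unfolding F_def using c by (auto intro: mult_left_le mult_left_le_one_le)
  then have \<gamma>c: "\<gamma> \<le> corr (h j) W H1 0" "\<gamma> \<le> corr (h j) W H2 0" using j(3) by auto
  have WH: "\<And>k. k \<in> H1 \<Longrightarrow> \<bar>W k\<bar> \<le> T" "\<And>k. k \<in> H2 \<Longrightarrow> \<bar>W k\<bar> \<le> T" using WT H by auto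
  obtain l1 where l1: "length l1 \<le> s" "set l1 \<subseteq> H1 \<times> {-T..T}" "corr (h j) W H1 0 \<le> list_corr (h j) l1 0"
      "list_corr (h j) l1 0 \<le> 1" "\<forall>k\<in>H1. \<exists>v\<in>cand (h j) m l1 k. \<bar>W k - v\<bar> \<le> h j"
    using exists_code[OF H(1) hj m WH(1) \<gamma>0 \<gamma>c(1), of s] s by (auto simp: \<gamma>_def)
  obtain l2 where l2: "length l2 \<le> s" "set l2 \<subseteq> H2 \<times> {-T..T}" "corr (h j) W H2 0 \<le> list_corr (h j) l2 0"
      "list_corr (h j) l2 0 \<le> 1" "\<forall>k\<in>H2. \<exists>v\<in>cand (h j) m l2 k. \<bar>W k - v\<bar> \<le> h j"
    using exists_code[OF H(2) hj m WH(2) \<gamma>0 \<gamma>c(2), of s] s by (auto simp: \<gamma>_def)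
  have Fl: "F j \<le> list_corr (h j) l1 0 * list_corr (h j) l2 0"
    unfolding F_def using l1(3) l2(3) c by (intro mult_mono) auto
  have "\<forall>k<n. \<exists>v\<in>(if k < n div 2 then cand (h j) m l1 k else cand (h j) m l2 k). \<bar>W k - v\<bar> \<le> h j"
    using l1(5) l2(5) by (auto simp: H1_def H2_def)
  then obtain V where V: "\<forall>k<n. V k \<in> (if k < n div 2 then cand (h j) m l1 k else cand (h j) m l2 k) \<and> \<bar>W k - V k\<bar> \<le> h j"
    by metis
  \<comment> \<open>Candidates are extensional functions, so \<open>V\<close> is cut off outside the
    index range.\<close>
  define W' where "W' = restrict V {..<n}"
  have W': "W' \<in> cands n (h j) m l1 l2" using V by (auto simp: cands_def W'_def)
  have close: "\<bar>W k - W' k\<bar> \<le> h j" if "k < n" for k using V that by (simp add: W'_def)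
  have "avg W' {..<n} (iball (rr j)) z \<le> conc_bound \<kappa> (h j) l1 l2" for z
  proof -
    have 1: "avg W' {..<n} (iball (rr j)) z \<le> avg W {..<n} (iball (rr j + h j * int n)) z"
      using avg_iball_perturb[of "{..<n}" W W' "h j" z z 0 "rr j"] close by simp
    obtain k where "k < n" "\<bar>W k\<bar> = T" using WT(2) by blast
    \<comment> \<open>The coordinate of size \<open>T\<close> exceeds even the enlarged
      radius.\<close>
    then have 2: "avg W {..<n} (iball (rr j + h j * int n)) z \<le> 1 / 2"
      using h(4)[OF j(1)] by (intro avg_iball_le_half[of _ k]) auto
    have "avg W {..<n} (iball (rr j + h j * int n)) z \<le> 2 * sqrt (F (Suc j))"
      using h(3)[OF j(1)] j(1) by (intro conc) auto
    also have "\<dots> \<le> 2 * sqrt (\<kappa> * (list_corr (h j) l1 0 * list_corr (h j) l2 0))"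
    proof -
      have "\<kappa> * F j \<le> \<kappa> * (list_corr (h j) l1 0 * list_corr (h j) l2 0)"
        using Fl \<kappa> by (intro mult_left_mono) auto
      then show ?thesis using j(2) by simp
    qed
    finally show ?thesis using 1 2 unfolding conc_bound_def by linarith
  qed
  moreover have "set l1 \<subseteq> {..<n} \<times> {-T..T}" "set l2 \<subseteq> {..<n} \<times> {-T..T}" using l1(2) l2(2) H(4) by auto
  moreover have "0 < list_corr (h j) l1 0" "0 < list_corr (h j) l2 0" using l1(3) l2(3) \<gamma>c \<gamma>0 by linarith+
  moreover have "\<delta> ^ 2 / 4 \<le> list_corr (h j) l1 0 * list_corr (h j) l2 0" using Fl j(3) by (simp add: \<gamma>_def)
  ultimately show ?thesis using j(1) l1 l2 W' close by blast
qed

section \<open>The least singular value\<close>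

lemma card_lists_le:
  assumes "n \<ge> 1" "T \<ge> 0"
  shows "finite {l. set l \<subseteq> {..<n} \<times> {-T..T} \<and> length l \<le> s}"
    "real (card {l. set l \<subseteq> {..<n} \<times> {-T..T} \<and> length l \<le> s}) \<le> real (Suc s) * (real n * (2 * real_of_int T + 1)) ^ s"
proof -
  let ?A = "{..<n} \<times> {-T..T}"
  define x where "x = real (card ?A)"
  have x: "x = real n * (2 * real_of_int T + 1)" using assms by (simp add: x_def)
  have x1: "1 \<le> x" unfolding x using mult_mono[of 1 "real n" 1 "2 * real_of_int T + 1"] assms by simp
  show "finite {l. set l \<subseteq> ?A \<and> length l \<le> s}" by (intro finite_lists_length_le) simp
  have "real (card {l. set l \<subseteq> ?A \<and> length l \<le> s}) = (\<Sum>i\<le>s. x ^ i)"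
    by (subst card_lists_length_le) (simp_all add: x_def)
  also have "\<dots> \<le> (\<Sum>i\<le>s. x ^ s)" using x1 by (intro sum_mono power_increasing) auto
  finally show "real (card {l. set l \<subseteq> ?A \<and> length l \<le> s}) \<le> real (Suc s) * (real n * (2 * real_of_int T + 1)) ^ s"
    by (simp add: x)
qed

lemma coin_entries_abs_le_1:
  assumes "\<xi> \<in> set_pmf (Pi_pmf I 0 (\<lambda>_. coin))" "finite I"
  shows "\<bar>\<xi> x\<bar> \<le> 1"
  using assms by (cases "x \<in> I") (auto simp: set_Pi_pmf PiE_dflt_def)

text \<open>Union bound over scales, pairs of codes and candidates. A candidate has to meet slightly
  weaker constraints in the \<open>n - 1\<close> independent columns other than \<open>i\<close>,
  and \<open>card_cands_times_power_le\<close> bounds the total for each code uniformly.\<close>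

lemma prob_rich_orthogonal_le:
  fixes h rr :: "nat \<Rightarrow> int" and M :: "nat \<Rightarrow> nat \<Rightarrow> int"
  assumes n: "n \<ge> 1" and i: "i < n"
    and h: "2 * r \<le> h 0" "\<And>j. j \<le> J \<Longrightarrow> h j > 0" "\<And>j. j < J \<Longrightarrow> 2 * (rr j + h j * int n) \<le> h (Suc j)"
      "\<And>j. j < J \<Longrightarrow> rr j + h j * int n < T" "\<And>j. j < J \<Longrightarrow> K + int n * (h j * \<beta>) \<le> rr j"
    and M: "\<And>k j. k < n \<Longrightarrow> j < n \<Longrightarrow> \<bar>M k j\<bar> + 1 \<le> \<beta>" and T: "T \<ge> 0"
    and \<delta>: "\<delta> > 0"
    and \<kappa>: "\<kappa> \<ge> 1" "1 < \<kappa> ^ J * (\<delta> ^ 2 / 4)" and m: "m \<ge> 4" "64 * \<kappa> \<le> real m"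
    and s: "(1 - 1 / (4 * real m ^ 2)) ^ Suc s < \<delta> ^ 2 / 4"
  shows "measure_pmf.prob (Pi_pmf ({..<n} \<times> {..<n}) 0 (\<lambda>_. coin))
     {\<xi>. \<exists>W. (\<forall>k<n. \<bar>W k\<bar> \<le> T) \<and> (\<exists>k<n. \<bar>W k\<bar> = T) \<and> (\<exists>z. \<delta> < avg W {..<n} (iball r) z) \<and>
        (\<forall>j<n. j \<noteq> i \<longrightarrow> \<bar>\<Sum>k<n. real_of_int (W k) * (real_of_int (M k j) + \<xi> (k, j))\<bar> \<le> real_of_int K)}
    \<le> real J * (real (Suc s) * (real n * (2 * real_of_int T + 1)) ^ s) ^ 2 *
        (1 / (\<delta> ^ 2 / 4) * (1 / 4) ^ ((n + 1) div 2 - 1))"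
    (is "measure_pmf.prob ?P ?E \<le> _ * ?L ^ 2 * ?\<tau>")
proof -
  define Ls where "Ls = {l. set l \<subseteq> {..<n} \<times> {-T..T} \<and> length l \<le> s}"
  \<comment> \<open>The index set of the union bound is deterministic; the vector that depends on
    \<open>\<xi>\<close> enters only in \<open>cover\<close>.\<close>
  define D where "D = {(j, l1, l2). j < J \<and> l1 \<in> Ls \<and> l2 \<in> Ls \<and>
    list_corr (h j) l1 0 \<le> 1 \<and> list_corr (h j) l2 0 \<le> 1 \<and> 0 < list_corr (h j) l1 0 \<and> 0 < list_corr (h j) l2 0 \<and>
    \<delta> ^ 2 / 4 \<le> list_corr (h j) l1 0 * list_corr (h j) l2 0}"
  define X where "X = (\<lambda>(j, l1, l2). {V \<in> cands n (h j) m l1 l2.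
    \<forall>z. avg V {..<n} (iball (rr j)) z \<le> conc_bound \<kappa> (h j) l1 l2})"
  define G where "G = (\<lambda>j V. {\<xi>. \<forall>j'\<in>{..<n} \<inter> (- {i}).
    \<bar>real_of_int (\<Sum>k<n. V k * M k j') + (\<Sum>k<n. real_of_int (V k) * \<xi> (k, j'))\<bar> \<le> real_of_int (rr j)})"
  have fL: "finite Ls" "real (card Ls) \<le> ?L"
    unfolding Ls_def using card_lists_le[OF n T] by blast+
  have D_sub: "D \<subseteq> {..<J} \<times> Ls \<times> Ls" by (auto simp: D_def)
  have finD: "finite D" using finite_subset[OF D_sub] fL by simp
  have "card D \<le> J * (card Ls * card Ls)"
    using card_mono[OF _ D_sub] fL by (simp add: card_cartesian_product)
  then have "real (card D) \<le> real J * (real (card Ls) * real (card Ls))"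
    by (metis of_nat_le_iff of_nat_mult)
  also have "\<dots> \<le> real J * (?L * ?L)" using fL by (intro mult_left_mono mult_mono) auto
  finally have cardD: "real (card D) \<le> real J * ?L ^ 2" by (simp add: power2_eq_square)
  have finX: "finite (X d)" if "d \<in> D" for d
    using that h(2) m card_cands_le(1) by (auto simp: D_def X_def)
  have m0: "m > 0" using m by simp
  have cover: "\<xi> \<in> (\<Union>d\<in>D. \<Union>V\<in>X d. G (fst d) V)" if \<xi>: "\<xi> \<in> set_pmf ?P" "\<xi> \<in> ?E" for \<xi>
  proof -
    obtain W z where W: "\<And>k. k < n \<Longrightarrow> \<bar>W k\<bar> \<le> T" "\<exists>k<n. \<bar>W k\<bar> = T" "\<delta> < avg W {..<n} (iball r) z"
      "\<And>j. j < n \<Longrightarrow> j \<noteq> i \<Longrightarrow> \<bar>\<Sum>k<n. real_of_int (W k) * (real_of_int (M k j) + \<xi> (k, j))\<bar> \<le> real_of_int K"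
      using \<xi>(2) by blast
    obtain j l1 l2 V where j: "j < J" and l: "(j, l1, l2) \<in> D" and V: "V \<in> X (j, l1, l2)"
        and close: "\<forall>k<n. \<bar>W k - V k\<bar> \<le> h j"
      using rich_vector_covered[OF W(1,2,3) \<delta> h(1-4) \<kappa> m0 s] unfolding D_def X_def Ls_def by fastforce
    have "\<bar>real_of_int (\<Sum>k<n. V k * M k j') + (\<Sum>k<n. real_of_int (V k) * \<xi> (k, j'))\<bar> \<le> real_of_int (rr j)"
      if j': "j' < n" "j' \<noteq> i" for j'
    proof -
      let ?a = "\<lambda>k. real_of_int (M k j') + \<xi> (k, j')"
      \<comment> \<open>Replacing \<open>W\<close> by \<open>V\<close> changes the form by at most
        \<open>n * (h j * \<beta>)\<close>, the allowance built into \<open>rr j\<close>.\<close>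
      have "real_of_int (\<Sum>k<n. V k * M k j') + (\<Sum>k<n. real_of_int (V k) * \<xi> (k, j'))
        = (\<Sum>k<n. real_of_int (W k) * ?a k) + (\<Sum>k<n. real_of_int (V k - W k) * ?a k)"
        by (simp add: sum.distrib[symmetric] algebra_simps)
      also have "\<bar>\<dots>\<bar> \<le> real_of_int K + (\<Sum>k<n. \<bar>real_of_int (V k - W k) * ?a k\<bar>)"
        using W(4)[OF j'] sum_abs[of "\<lambda>k. real_of_int (V k - W k) * ?a k" "{..<n}"] by linarith
      also have "(\<Sum>k<n. \<bar>real_of_int (V k - W k) * ?a k\<bar>) \<le> (\<Sum>k<n. real_of_int (h j) * real_of_int \<beta>)"
        unfolding abs_mult
      proof (intro sum_mono mult_mono)
        fix k assume "k \<in> {..<n}"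
        then have k: "k < n" by simp
        show "\<bar>real_of_int (V k - W k)\<bar> \<le> real_of_int (h j)"
          using close k by (metis abs_minus_commute of_int_abs of_int_le_iff)
        have "\<bar>?a k\<bar> \<le> real_of_int \<bar>M k j'\<bar> + 1"
          using coin_entries_abs_le_1[OF \<xi>(1), of "(k, j')"] by simp
        also have "\<dots> = real_of_int (\<bar>M k j'\<bar> + 1)" by simp
        also have "\<dots> \<le> real_of_int \<beta>" using M[OF k j'(1)] by (simp only: of_int_le_iff)
        finally show "\<bar>?a k\<bar> \<le> real_of_int \<beta>" .
      qed (use h(2)[of j] j in auto)
      also have "(\<Sum>k<n. real_of_int (h j) * real_of_int \<beta>) = real_of_int (int n * (h j * \<beta>))" by simp
      also have "real_of_int K + real_of_int (int n * (h j * \<beta>)) \<le> real_of_int (rr j)"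
        using h(5)[OF j] by (metis of_int_add of_int_le_iff)
      finally show ?thesis by simp
    qed
    then have "\<xi> \<in> G j V" by (auto simp: G_def)
    then show ?thesis using l V by force
  qed
  have probG: "measure_pmf.prob ?P (G j V) \<le> conc_bound \<kappa> (h j) l1 l2 ^ (n - 1)"
    if "(j, l1, l2) \<in> D" "V \<in> X (j, l1, l2)" for j l1 l2 V
  proof -
    have "0 \<le> conc_bound \<kappa> (h j) l1 l2" using that(1) \<kappa>(1) by (auto simp: conc_bound_def D_def)
    moreover have "{..<n} \<inter> - {i} = {..<n} - {i}" by auto
    then have "card ({..<n} \<inter> - {i}) = n - 1" using i by simp
    ultimately show ?thesis
      using prob_columns_le[of "{..<n}" "{..<n}" V "rr j" "conc_bound \<kappa> (h j) l1 l2" "- {i}" "\<lambda>j'. \<Sum>k<n. V k * M k j'"] that(2)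
      unfolding G_def X_def by simp
  qed
  have "measure_pmf.prob ?P ?E \<le> measure_pmf.prob ?P (\<Union>d\<in>D. \<Union>V\<in>X d. G (fst d) V)"
    by (rule measure_pmf.finite_measure_mono_AE) (use cover in \<open>auto simp: AE_measure_pmf_iff\<close>)
  also have "\<dots> \<le> (\<Sum>d\<in>D. measure_pmf.prob ?P (\<Union>V\<in>X d. G (fst d) V))"
    by (rule measure_pmf.finite_measure_subadditive_finite[OF finD]) auto
  also have "\<dots> \<le> (\<Sum>d\<in>D. ?\<tau>)"
  proof (rule sum_mono)
    fix d assume d: "d \<in> D"
    obtain j l1 l2 where dj: "d = (j, l1, l2)" by (cases d) auto
    have j: "j < J" using d by (simp add: dj D_def)
    have "measure_pmf.prob ?P (\<Union>V\<in>X d. G (fst d) V) \<le> (\<Sum>V\<in>X d. measure_pmf.prob ?P (G (fst d) V))"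
      by (rule measure_pmf.finite_measure_subadditive_finite[OF finX[OF d]]) auto
    also have "\<dots> \<le> (\<Sum>V\<in>X d. conc_bound \<kappa> (h j) l1 l2 ^ (n - 1))"
      by (intro sum_mono) (use probG d in \<open>auto simp: dj\<close>)
    also have "\<dots> \<le> real (card (cands n (h j) m l1 l2)) * conc_bound \<kappa> (h j) l1 l2 ^ (n - 1)"
    proof -
      have "card (X d) \<le> card (cands n (h j) m l1 l2)"
        using d h(2)[of j] j m card_cands_le(1) by (intro card_mono) (auto simp: dj X_def D_def)
      moreover have "0 \<le> conc_bound \<kappa> (h j) l1 l2" using d \<kappa>(1) by (auto simp: conc_bound_def D_def dj)
      ultimately show ?thesis by (simp add: mult_right_mono)
    qed
    also have "\<dots> \<le> ?\<tau>"
      by (rule card_cands_times_power_le) (use d h(2)[of j] j m n \<kappa> \<delta> in \<open>auto simp: dj D_def\<close>)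
    finally show "measure_pmf.prob ?P (\<Union>V\<in>X d. G (fst d) V) \<le> ?\<tau>" .
  qed
  also have "\<dots> = real (card D) * ?\<tau>" by simp
  also have "\<dots> \<le> real J * ?L ^ 2 * ?\<tau>" by (intro mult_right_mono cardD) auto
  finally show ?thesis .
qed

text \<open>For the bad column \<open>i\<close>, the vector selected from the other columns is
  either rich, and the covering bound applies to those columns, or poor, and column \<open>i\<close>
  alone costs \<open>\<delta>\<close>. The radius is twice \<open>n * \<beta>\<close> because column
  \<open>i\<close> satisfies only the weaker of the two column bounds.\<close>

lemma prob_inverse_op_norm_le:
  fixes h rr :: "nat \<Rightarrow> int" and M :: "int mat"
  assumes n: "n \<ge> 1" and M: "M \<in> carrier_mat n n"
    and h: "4 * (int n * \<beta>) \<le> h 0" "\<And>j. j \<le> J \<Longrightarrow> h j > 0" "\<And>j. j < J \<Longrightarrow> 2 * (rr j + h j * int n) \<le> h (Suc j)"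
      "\<And>j. j < J \<Longrightarrow> rr j + h j * int n < T" "\<And>j. j < J \<Longrightarrow> int n * \<beta> + int n * (h j * \<beta>) \<le> rr j"
    and \<beta>: "\<And>k j. k < n \<Longrightarrow> j < n \<Longrightarrow> \<bar>M $$ (k, j)\<bar> + 1 \<le> \<beta>" and T: "T > 0"
    and b: "b > 0" "2 * real n ^ 2 * real_of_int T \<le> b * (real n * real_of_int \<beta>)"
    and \<delta>: "\<delta> > 0"
    and \<kappa>: "\<kappa> \<ge> 1" "1 < \<kappa> ^ J * (\<delta> ^ 2 / 4)" and m: "m \<ge> 4" "64 * \<kappa> \<le> real m"
    and s: "(1 - 1 / (4 * real m ^ 2)) ^ Suc s < \<delta> ^ 2 / 4"
  shows "measure_pmf.prob (bernoulli_matrix n) {N. inverse_op_norm (map_mat real_of_int M + N) \<ge> ennreal b}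
    \<le> real n * (\<delta> + real J * (real (Suc s) * (real n * (2 * real_of_int T + 1)) ^ s) ^ 2 *
        (1 / (\<delta> ^ 2 / 4) * (1 / 4) ^ ((n + 1) div 2 - 1)))"
    (is "_ \<le> real n * (\<delta> + ?\<rho>)")
proof -
  let ?P = "Pi_pmf ({..<n} \<times> {..<n}) 0 (\<lambda>_. coin)"
  let ?K = "int n * \<beta>"
  define a where "a = (\<lambda>\<xi> k j. real_of_int (M $$ (k, j)) + (\<xi> (k, j) :: real))"
  define E where "E = {\<xi>. inverse_op_norm (map_mat real_of_int M + mat n n \<xi>) \<ge> ennreal b}"
  define sel where "sel = (\<lambda>i \<xi>. SOME W. rounded_orthogonal n T i (a \<xi>) W)"
  define Rich where "Rich i = {\<xi>. \<exists>W. (\<forall>k<n. \<bar>W k\<bar> \<le> T) \<and> (\<exists>k<n. \<bar>W k\<bar> = T) \<and>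
    (\<exists>z. \<delta> < avg W {..<n} (iball (2 * ?K)) z) \<and>
    (\<forall>j<n. j \<noteq> i \<longrightarrow> \<bar>\<Sum>k<n. real_of_int (W k) * (real_of_int (M $$ (k, j)) + \<xi> (k, j))\<bar> \<le> real_of_int ?K)}" for i
  define Poor where "Poor i = {\<xi>. (\<forall>z. avg (sel i \<xi>) {..<n} (iball (2 * ?K)) z \<le> \<delta>) \<and>
    \<bar>real_of_int (\<Sum>k<n. sel i \<xi> k * M $$ (k, i)) + (\<Sum>k<n. real_of_int (sel i \<xi> k) * \<xi> (k, i))\<bar> \<le> real_of_int (2 * ?K)}" for i
  have rich: "measure_pmf.prob ?P (Rich i) \<le> ?\<rho>" if "i < n" for i
    unfolding Rich_def
    by (rule prob_rich_orthogonal_le[where M = "\<lambda>k j. M $$ (k, j)" and h = h and rr = rr and \<kappa> = \<kappa> and m = m and \<beta> = \<beta>])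
      (use n h \<beta> T \<delta> \<kappa> m s that in auto)
  have poor: "measure_pmf.prob ?P (Poor i) \<le> \<delta>" if "i < n" for i
    unfolding Poor_def
  proof (rule prob_selected_column_le[where c = "\<lambda>W. \<Sum>k<n. W k * M $$ (k, i)"])
    fix \<xi> \<xi>' :: "nat \<times> nat \<Rightarrow> real"
    assume eq: "\<And>k j. k \<in> {..<n} \<Longrightarrow> j \<in> {..<n} - {i} \<Longrightarrow> \<xi> (k, j) = \<xi>' (k, j)"
    \<comment> \<open>The predicates agree as functions of \<open>W\<close>, so \<open>SOME\<close>
      picks the same vector.\<close>
    have "rounded_orthogonal n T i (a \<xi>) = rounded_orthogonal n T i (a \<xi>')"
      by (intro ext rounded_orthogonal_cong) (simp add: a_def eq)
    then show "sel i \<xi> = sel i \<xi>'" by (simp add: sel_def)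
  qed (use that \<delta> in auto)
  have cover: "\<xi> \<in> (\<Union>i<n. Rich i \<union> Poor i)" if \<xi>: "\<xi> \<in> set_pmf ?P" "\<xi> \<in> E" for \<xi>
  proof -
    let ?A = "map_mat real_of_int M + mat n n \<xi>"
    have A: "?A \<in> carrier_mat n n" by simp
    have Aa: "?A $$ (k, j) = a \<xi> k j" if "k < n" "j < n" for k j using that M by (simp add: a_def)
    have sumA: "(\<Sum>k<n. w k * ?A $$ (k, j)) = (\<Sum>k<n. w k * a \<xi> k j)" if "j < n" for w :: "nat \<Rightarrow> real" and j
      by (rule sum.cong) (use Aa that in auto)
    have "inverse_op_norm ?A \<ge> ennreal b" using \<xi>(2) by (simp only: E_def mem_Collect_eq)
    then obtain i where i0: "i < n" "\<forall>w. (\<forall>k<n. \<bar>w k\<bar> \<le> 1) \<longrightarrow> (\<forall>j<n. j \<noteq> i \<longrightarrow> (\<Sum>k<n. w k * ?A $$ (k, j)) = 0) \<longrightarrow>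
      b * \<bar>\<Sum>k<n. w k * ?A $$ (k, i)\<bar> \<le> 2 * real n ^ 2"
      using inverse_op_norm_ge_imp_column[OF A b(1)] by blast
    have "b * \<bar>\<Sum>k<n. w k * a \<xi> k i\<bar> \<le> 2 * real n ^ 2"
      if w: "\<forall>k<n. \<bar>w k\<bar> \<le> 1" "\<forall>j<n. j \<noteq> i \<longrightarrow> (\<Sum>k<n. w k * a \<xi> k j) = 0" for w
    proof -
      have "\<forall>j<n. j \<noteq> i \<longrightarrow> (\<Sum>k<n. w k * ?A $$ (k, j)) = 0"
        using w(2) sumA by (metis (no_types, lifting))
      then have "b * \<bar>\<Sum>k<n. w k * ?A $$ (k, i)\<bar> \<le> 2 * real n ^ 2" using i0(2) w(1) by blast
      then show ?thesis by (simp only: sumA[OF i0(1)])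
    qed
    with i0(1) have i: "i < n" "\<forall>w. (\<forall>k<n. \<bar>w k\<bar> \<le> 1) \<longrightarrow> (\<forall>j<n. j \<noteq> i \<longrightarrow> (\<Sum>k<n. w k * a \<xi> k j) = 0) \<longrightarrow>
      b * \<bar>\<Sum>k<n. w k * a \<xi> k i\<bar> \<le> 2 * real n ^ 2"
      by blast+
    have ro: "rounded_orthogonal n T i (a \<xi>) (sel i \<xi>)"
      using someI_ex[OF exists_rounded_orthogonal[OF i(1) T, of "a \<xi>"]] by (simp add: sel_def)
    have bd: "\<bar>a \<xi> k j\<bar> \<le> real_of_int \<beta>" if "k < n" "j < n" for k j
    proof -
      have "\<bar>a \<xi> k j\<bar> \<le> real_of_int (\<bar>M $$ (k, j)\<bar> + 1)"
        using coin_entries_abs_le_1[OF \<xi>(1), of "(k, j)"] by (simp add: a_def)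
      also have "\<dots> \<le> real_of_int \<beta>" using \<beta>[OF that] by (simp only: of_int_le_iff)
      finally show ?thesis .
    qed
    have le: "\<bar>\<Sum>k<n. real_of_int (sel i \<xi> k) * (real_of_int (M $$ (k, j)) + \<xi> (k, j))\<bar> \<le> real_of_int ?K"
      if "j < n" "j \<noteq> i" for j
    proof -
      have "\<bar>\<Sum>k<n. real_of_int (sel i \<xi> k) * a \<xi> k j\<bar> \<le> real n * real_of_int \<beta>"
        by (rule rounded_orthogonal_columns_le(1)[OF ro T b(1) bd i b(2) that])
      then show ?thesis by (simp add: a_def)
    qed
    have "\<bar>\<Sum>k<n. real_of_int (sel i \<xi> k) * a \<xi> k i\<bar> \<le> 2 * (real n * real_of_int \<beta>)"
      by (rule rounded_orthogonal_columns_le(2)[OF ro T b(1) bd i b(2)])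
    moreover have "(\<Sum>k<n. real_of_int (sel i \<xi> k) * a \<xi> k i)
      = real_of_int (\<Sum>k<n. sel i \<xi> k * M $$ (k, i)) + (\<Sum>k<n. real_of_int (sel i \<xi> k) * \<xi> (k, i))"
      by (simp add: a_def sum.distrib[symmetric] algebra_simps)
    ultimately have lei: "\<bar>real_of_int (\<Sum>k<n. sel i \<xi> k * M $$ (k, i)) + (\<Sum>k<n. real_of_int (sel i \<xi> k) * \<xi> (k, i))\<bar> \<le> real_of_int (2 * ?K)"
      by simp
    have "\<xi> \<in> Rich i \<union> Poor i"
    proof (cases "\<forall>z. avg (sel i \<xi>) {..<n} (iball (2 * ?K)) z \<le> \<delta>")
      case True
      then show ?thesis using lei by (simp add: Poor_def)
    next
      case False
      then have "\<exists>z. \<delta> < avg (sel i \<xi>) {..<n} (iball (2 * ?K)) z" by (simp add: not_le)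
      moreover have "\<forall>k<n. \<bar>sel i \<xi> k\<bar> \<le> T" "\<exists>k<n. \<bar>sel i \<xi> k\<bar> = T"
        using ro by (auto simp: rounded_orthogonal_def)
      ultimately have "\<xi> \<in> Rich i" using le unfolding Rich_def by blast
      then show ?thesis by simp
    qed
    then show ?thesis using i(1) by blast
  qed
  have "measure_pmf.prob (bernoulli_matrix n) {N. inverse_op_norm (map_mat real_of_int M + N) \<ge> ennreal b}
      = measure_pmf.prob ?P E"
    by (simp add: bernoulli_matrix_def measure_map_pmf vimage_def E_def)
  also have "\<dots> \<le> measure_pmf.prob ?P (\<Union>i<n. Rich i \<union> Poor i)"
    by (rule measure_pmf.finite_measure_mono_AE) (use cover in \<open>auto simp: AE_measure_pmf_iff\<close>)
  also have "\<dots> \<le> (\<Sum>i<n. measure_pmf.prob ?P (Rich i \<union> Poor i))"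
    by (rule measure_pmf.finite_measure_subadditive_finite) auto
  also have "\<dots> \<le> (\<Sum>i<n. \<delta> + ?\<rho>)"
  proof (rule sum_mono)
    fix i assume "i \<in> {..<n}"
    then have "i < n" by simp
    have "measure_pmf.prob ?P (Rich i \<union> Poor i) \<le> measure_pmf.prob ?P (Rich i) + measure_pmf.prob ?P (Poor i)"
      by (rule measure_Un_le) auto
    then show "measure_pmf.prob ?P (Rich i \<union> Poor i) \<le> \<delta> + ?\<rho>"
      using rich[OF \<open>i < n\<close>] poor[OF \<open>i < n\<close>] by linarith
  qed
  also have "\<dots> = real n * (\<delta> + ?\<rho>)" by simp
  finally show ?thesis .
qed

text \<open>\<open>\<sigma> n\<close> has order \<open>sqrt n * ln n\<close>, so the number of codes
  is only exponential in \<open>sqrt n * (ln n)^2\<close>, and \<open>2 powr (- n)\<close> outweighs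
  it together with any polynomial.\<close>

lemma entropy_beaten:
  fixes A J d a :: real
  assumes "a > 0" "d > 0"
  defines "\<sigma> \<equiv> \<lambda>n. 4 * sqrt (real n) * (ln 4 + 2 * a * ln (real n)) + 2"
  shows "\<forall>\<^sub>F n in sequentially. real n * (J * (\<sigma> n * real n powr (d * \<sigma> n)) ^ 2 *
    (16 * real n powr (2 * a) * 2 powr (- real n))) \<le> real n powr (- A) / 2"
  unfolding \<sigma>_def using assms(1,2) by real_asymp

theorem theorem2p5:
  fixes A C :: real
  shows "\<exists>B :: real. \<forall>\<^sub>F n in sequentially.
    \<forall>M :: int mat. M \<in> carrier_mat n n \<longrightarrow>
      (\<forall>i<n. \<forall>j<n. real_of_int \<bar>M $$ (i, j)\<bar> \<le> real n powr C) \<longrightarrow>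
      measure_pmf.prob (bernoulli_matrix n)
        {N. inverse_op_norm (map_mat real_of_int M + N) \<ge> ennreal (real n powr B)}
      \<le> real n powr (- A)"
proof -
  \<comment> \<open>Entries are at most \<open>n^c\<close>, and \<open>\<delta>\<close> will be
    \<open>n^(-a)\<close>. With \<open>\<kappa> = n^(1/8)\<close>, \<open>J\<close> is chosen so
    that \<open>\<kappa>^J = n^(2 * a + 1)\<close>. The ratio of consecutive scales is
    \<open>n^e\<close>, and \<open>n^d\<close> is \<open>n^2\<close> times the top scale.\<close>
  define c where "c = nat \<lceil>max C 0\<rceil>"
  define a where "a = nat \<lceil>max A 0\<rceil> + 2"
  define J where "J = 16 * a + 8"
  define e where "e = c + 3"
  define d where "d = e * (J + 1) + 2"
  define \<sigma> where "\<sigma> n = 4 * sqrt (real n) * (ln 4 + 2 * real a * ln (real n)) + 2" for n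
  have C: "C \<le> real c" unfolding c_def by (rule order.trans[OF _ real_nat_ceiling_ge]) simp
  have "A \<le> real (nat \<lceil>max A 0\<rceil>)" by (rule order.trans[OF _ real_nat_ceiling_ge]) simp
  then have A: "A + 2 \<le> real a" by (simp add: a_def)
  have ad: "0 < a" "0 < d" by (simp_all add: a_def d_def)
  have ev: "\<forall>\<^sub>F n in sequentially. n \<ge> 6 \<and> 64 * real n powr (1/8) \<le> real n powr (1/4) - 1 \<and>
    4 \<le> real n powr (1/4) - 1 \<and>
    real n * (real J * (\<sigma> n * real n powr (real d * \<sigma> n)) ^ 2 *
      (16 * real n powr (2 * real a) * 2 powr (- real n))) \<le> real n powr (- A) / 2"
  proof (intro eventually_conj)
    show "\<forall>\<^sub>F n in sequentially. 64 * real n powr (1/8) \<le> real n powr (1/4) - 1" by real_asymp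
    show "\<forall>\<^sub>F n in sequentially. 4 \<le> real n powr (1/4) - 1" by real_asymp
    show "\<forall>\<^sub>F n in sequentially. real n * (real J * (\<sigma> n * real n powr (real d * \<sigma> n)) ^ 2 *
      (16 * real n powr (2 * real a) * 2 powr (- real n))) \<le> real n powr (- A) / 2"
      unfolding \<sigma>_def by (rule entropy_beaten) (use ad in auto)
  qed (rule eventually_ge_at_top)
  show ?thesis
  proof (intro exI[of _ "real d"] eventually_mono[OF ev] allI impI, elim conjE)
    fix n :: nat and M :: "int mat"
    assume M: "M \<in> carrier_mat n n"
      and Mb: "\<forall>i<n. \<forall>j<n. real_of_int \<bar>M $$ (i, j)\<bar> \<le> real n powr C"
      and n6: "n \<ge> 6" and m64: "64 * real n powr (1/8) \<le> real n powr (1/4) - 1"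
      and m4: "4 \<le> real n powr (1/4) - 1"
      and asymp: "real n * (real J * (\<sigma> n * real n powr (real d * \<sigma> n)) ^ 2 *
        (16 * real n powr (2 * real a) * 2 powr (- real n))) \<le> real n powr (- A) / 2"
    \<comment> \<open>The top scale \<open>h J\<close> also serves as the size \<open>T\<close> of
      the integer vectors. \<open>P\<close> is \<open>n\<close> times the entry bound
      \<open>n^(c + 1)\<close>, so consecutive scales differ by the factor
      \<open>n * P\<close>.\<close>
    define h where "h j = int n ^ (e * (j + 1))" for j
    define P where "P = int n ^ (c + 2)"
    define rr where "rr j = P + P * h j" for j
    define \<delta> where "\<delta> = 1 / real n ^ a"
    define \<kappa> where "\<kappa> = real n powr (1/8)"
    define m where "m = nat \<lfloor>real n powr (1/4)\<rfloor>"
    \<comment> \<open>\<open>exp (- L)\<close> is \<open>\<delta>^2 / 4\<close>; at decay rate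
      \<open>1 / (4 * m^2)\<close> per greedy step, \<open>4 * m^2 * L\<close> steps reach
      it.\<close>
    define L where "L = ln 4 + 2 * real a * ln (real n)"
    define s where "s = nat \<lceil>4 * real m ^ 2 * L\<rceil>"
    have n1: "int n \<ge> 6" "real n \<ge> 6" using n6 by auto
    have P: "P \<ge> int n" "int n * int n ^ (c + 1) = P" "int n ^ e = int n * P"
      using n1 self_le_power[of "int n" "c + 2"] by (auto simp: P_def e_def power_add eval_nat_numeral)
    have h1: "h j \<ge> 1" for j using n1 by (simp add: h_def one_le_power)
    have hpos: "h j > 0" for j using n1 by (simp add: h_def)
    have hS: "h (Suc j) = int n * P * h j" for j
      unfolding h_def P(3)[symmetric] by (simp add: power_add[symmetric])
    have Ph: "P \<le> P * h j" "int n * h j \<le> P * h j" "0 < P * h j" for j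
      using h1[of j] P(1) n1 by (auto intro: mult_right_mono simp: mult_le_cancel_left1)
    have rrh: "rr j + h j * int n \<le> 3 * (P * h j)" for j
      using Ph[of j] by (simp add: rr_def mult.commute)
    have h6: "6 * (P * h j) \<le> h (Suc j)" for j
    proof -
      have "6 * (P * h j) \<le> int n * (P * h j)" using Ph(3)[of j] n1 by (intro mult_right_mono) auto
      then show ?thesis by (simp add: hS mult.assoc)
    qed
    have hJ: "h (Suc j) \<le> h J" if "j < J" for j
      unfolding h_def using n1 that by (intro power_increasing mult_left_mono) auto
    have m: "real m \<le> real n powr (1/4)" "real n powr (1/4) - 1 \<le> real m"
      unfolding m_def using n1 by (simp_all add: of_nat_nat)
    have m_ge: "m \<ge> 4" using m(2) m4 by linarith
    have L: "L > 0" using n1 by (simp add: L_def add_pos_nonneg)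
    have s: "4 * real m ^ 2 * L \<le> real s" "real s \<le> 4 * real m ^ 2 * L + 1"
      unfolding s_def using L by (auto simp: of_nat_nat) 
    have expL: "exp (- L) = \<delta> ^ 2 / 4"
    proof -
      have "exp L = 4 * real n powr (2 * real a)"
        using n1 by (simp add: L_def exp_add powr_def)
      also have "\<dots> = 4 * real n ^ (2 * a)"
        using n1 powr_realpow[of "real n" "2 * a"] by simp
      finally show ?thesis by (simp add: exp_minus \<delta>_def power_mult[symmetric] power_divide mult.commute field_simps)
    qed
    have \<delta>: "\<delta> > 0" using n1 by (simp add: \<delta>_def)
    have s_cond: "(1 - 1 / (4 * real m ^ 2)) ^ Suc s < \<delta> ^ 2 / 4"
    proof -
      define x where "x = 1 / (4 * real m ^ 2)"
      have m2: "real m ^ 2 > 0" using m_ge by simp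
      have "1 \<le> y \<Longrightarrow> 0 < 1 / (4 * y) \<and> 1 / (4 * y) \<le> 1" for y :: real by (simp add: divide_simps)
      moreover have "1 \<le> real m ^ 2" using m_ge by (intro one_le_power) auto
      ultimately have x: "0 < x" "x \<le> 1" unfolding x_def by blast+
      have "(1 - x) ^ Suc s \<le> exp (- x) ^ Suc s"
        using x exp_ge_add_one_self[of "- x"] by (intro power_mono) auto
      also have "\<dots> = exp (- (x * real (Suc s)))"
        by (simp only: exp_of_nat_mult[symmetric] mult_minus_right mult.commute[of x])
      also have "\<dots> < exp (- L)"
      proof -
        have "L = x * (4 * real m ^ 2 * L)" using m2 by (simp add: x_def)
        \<comment> \<open>The extra step in \<open>Suc s\<close> makes the inequality
          strict.\<close>
        also have "\<dots> < x * real (Suc s)" using s(1) x(1) by (intro mult_strict_left_mono) auto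
        finally show ?thesis by simp
      qed
      finally show ?thesis by (simp add: x_def expL)
    qed
    have b: "real n powr real d = real n ^ 2 * real_of_int (h J)"
    proof -
      have "real n powr real d = real n ^ d" using n1 by (intro powr_realpow) auto
      also have "\<dots> = real n ^ 2 * real n ^ (e * (J + 1))" unfolding d_def power_add by (simp only: mult.commute)
      finally show ?thesis by (simp add: h_def)
    qed
    have "measure_pmf.prob (bernoulli_matrix n) {N. inverse_op_norm (map_mat real_of_int M + N) \<ge> ennreal (real n powr real d)}
      \<le> real n * (\<delta> + real J * (real (Suc s) * (real n * (2 * real_of_int (h J) + 1)) ^ s) ^ 2 *
        (1 / (\<delta> ^ 2 / 4) * (1 / 4) ^ ((n + 1) div 2 - 1)))"
    proof (rule prob_inverse_op_norm_le[where h = h and rr = rr and \<beta> = "int n ^ (c + 1)" and \<kappa> = \<kappa> and m = m])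
      show "4 * (int n * int n ^ (c + 1)) \<le> h 0"
      proof -
        have "4 * P \<le> int n * P" using P(1) n1 by (intro mult_right_mono) auto
        then show ?thesis by (simp only: P(2)) (simp add: h_def P(3))
      qed
      show "2 * (rr j + h j * int n) \<le> h (Suc j)" for j
        using order.trans[OF mult_left_mono[OF rrh, of 2 j] _, of "h (Suc j)"] h6[of j] by simp
      show "rr j + h j * int n < h J" if "j < J" for j
      proof -
        have "3 * (P * h j) < 6 * (P * h j)" using Ph(3)[of j] by simp
        then show ?thesis using rrh[of j] h6[of j] hJ[OF that] by (meson le_less_trans less_le_trans)
      qed
      show "int n * int n ^ (c + 1) + int n * (h j * int n ^ (c + 1)) \<le> rr j" for j
        by (simp add: rr_def P_def algebra_simps eval_nat_numeral)
      show "\<bar>M $$ (k, j)\<bar> + 1 \<le> int n ^ (c + 1)" if "k < n" "j < n" for k j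
      proof -
        have "real_of_int \<bar>M $$ (k, j)\<bar> \<le> real n powr C" using Mb that by blast
        also have "\<dots> \<le> real n powr real c" using C n1 by (intro powr_mono) auto
        also have "\<dots> = real_of_int (int n ^ c)" using n1 by (simp add: powr_realpow)
        finally have "\<bar>M $$ (k, j)\<bar> \<le> int n ^ c" by (simp only: of_int_le_iff)
        moreover have "1 \<le> int n ^ c" using n1 by (simp add: one_le_power)
        \<comment> \<open>The random sign adds 1 to the entry bound; one spare power of
          \<open>n\<close> absorbs it.\<close>
        moreover have "2 * int n ^ c \<le> int n * int n ^ c" using n1 by (intro mult_right_mono) auto
        ultimately show ?thesis by simp
      qed
      show "2 * real n ^ 2 * real_of_int (h J) \<le> real n powr real d * (real n * real_of_int (int n ^ (c + 1)))"
      proof -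
        have "2 \<le> real_of_int P" using P(1) n1 by linarith
        moreover have "real n * real_of_int (int n ^ (c + 1)) = real_of_int P" by (simp flip: P(2))
        ultimately have "(real n ^ 2 * real_of_int (h J)) * 2 \<le> (real n ^ 2 * real_of_int (h J)) * (real n * real_of_int (int n ^ (c + 1)))"
          using h1[of J] by (intro mult_left_mono) auto
        then show ?thesis unfolding b by (simp add: mult_ac)
      qed
      show "\<kappa> \<ge> 1" using n1 by (simp add: \<kappa>_def ge_one_powr_ge_zero)
      show "1 < \<kappa> ^ J * (\<delta> ^ 2 / 4)"
      proof -
        have "\<kappa> ^ J = real n powr (real J / 8)" using n1 by (simp add: \<kappa>_def powr_power)
        also have "real J / 8 = real (2 * a + 1)" by (simp add: J_def)
        also have "real n powr \<dots> = real n ^ (2 * a + 1)" using n1 by (intro powr_realpow) auto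
        finally have "\<kappa> ^ J * (\<delta> ^ 2 / 4) = real n / 4"
          using n1 by (simp add: \<delta>_def power_divide power_mult[symmetric] mult.commute)
        then show ?thesis using n1 by simp
      qed
      show "64 * \<kappa> \<le> real m" using m64 m(2) by (simp add: \<kappa>_def)
    qed (use n6 M hpos \<delta> m_ge s_cond in auto)
    also have "\<dots> = real n * \<delta> + real n * (real J * (real (Suc s) * (real n * (2 * real_of_int (h J) + 1)) ^ s) ^ 2 *
        (1 / (\<delta> ^ 2 / 4) * (1 / 4) ^ ((n + 1) div 2 - 1)))" by (simp add: distrib_left)
    also have "\<dots> \<le> real n powr (- A) / 2 + real n powr (- A) / 2"
    proof (rule add_mono)
      \<comment> \<open>After the sum over columns, \<open>A + 2 \<le> a\<close> leaves one power of
        \<open>n\<close> to spare, which pays for the factor 1/2.\<close>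
      have "real n * \<delta> = real n powr (1 - real a)"
        using n1 by (simp add: \<delta>_def powr_diff powr_realpow)
      also have "\<dots> \<le> real n powr (- A - 1)" using A n1 by (intro powr_mono) auto
      also have "\<dots> = real n powr (- A) / real n" using n1 by (simp add: powr_diff)
      also have "\<dots> \<le> real n powr (- A) / 2" using n1 by (intro divide_left_mono) auto
      finally show "real n * \<delta> \<le> real n powr (- A) / 2" .
      have "real m ^ 2 \<le> (real n powr (1/4)) ^ 2" using m by (intro power_mono) auto
      also have "\<dots> = sqrt (real n)" using n1 by (simp add: powr_power powr_half_sqrt)
      finally have "4 * real m ^ 2 * L \<le> 4 * sqrt (real n) * L" using L by (intro mult_right_mono) auto
      then have S: "real (Suc s) \<le> \<sigma> n" using s(2) by (simp add: \<sigma>_def L_def)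
      then have \<sigma>0: "0 \<le> \<sigma> n" by (rule order.trans[OF of_nat_0_le_iff])
      \<comment> \<open>The number of index-value pairs is at most \<open>n^2 * h J\<close>, which
        is \<open>n^d\<close>.\<close>
      have "real n * (2 * real_of_int (h J) + 1) \<le> real n * (real n * real_of_int (h J))"
      proof (rule mult_left_mono)
        have hr: "real_of_int (h J) \<ge> 1" using h1[of J] by linarith
        have "3 * real_of_int (h J) \<le> real n * real_of_int (h J)" using n1 hr by (intro mult_right_mono) auto
        then show "2 * real_of_int (h J) + 1 \<le> real n * real_of_int (h J)" using hr by linarith
      qed simp
      also have "\<dots> = real n powr real d" unfolding b by (simp add: power2_eq_square)
      finally have "(real n * (2 * real_of_int (h J) + 1)) ^ s \<le> (real n powr real d) ^ s"
        using h1[of J] by (intro power_mono) auto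
      also have "\<dots> = real n powr (real d * real s)" using n1 by (simp add: powr_power mult.commute)
      also have "\<dots> \<le> real n powr (real d * \<sigma> n)" using S n1 by (intro powr_mono mult_left_mono) auto
      finally have pw: "(real n * (2 * real_of_int (h J) + 1)) ^ s \<le> real n powr (real d * \<sigma> n)" .
      have inv: "1 / (\<delta> ^ 2 / 4) = 4 * real n powr (2 * real a)"
        using n1 powr_realpow[of "real n" "2 * a"] by (simp add: \<delta>_def power_divide power_mult[symmetric] mult.commute)
      \<comment> \<open>\<open>2 * k\<close> falls short of \<open>n\<close> by at most 2, whence
        the factor 4 below.\<close>
      define k where "k = (n + 1) div 2 - 1"
      have k: "n \<le> 2 * k + 2" using n6 by (simp add: k_def)
      have "(1 / 4 :: real) ^ k = 4 * (1 / 2) ^ (2 * k + 2)"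
        by (simp add: power_add power_mult power2_eq_square)
      also have "\<dots> \<le> 4 * (1 / 2) ^ n" using power_decreasing[OF k, of "1 / 2 :: real"] by simp
      also have "(1 / 2 :: real) ^ n = 2 powr (- real n)" by (simp add: powr_minus powr_realpow power_one_over inverse_eq_divide)
      finally have quarter: "(1 / 4 :: real) ^ ((n + 1) div 2 - 1) \<le> 4 * 2 powr (- real n)" by (simp add: k_def)
      have "real n * (real J * (real (Suc s) * (real n * (2 * real_of_int (h J) + 1)) ^ s) ^ 2 *
          (1 / (\<delta> ^ 2 / 4) * (1 / 4) ^ ((n + 1) div 2 - 1)))
        \<le> real n * (real J * (\<sigma> n * real n powr (real d * \<sigma> n)) ^ 2 *
          (4 * real n powr (2 * real a) * (4 * 2 powr (- real n))))"
        unfolding inv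
        by (intro mult_left_mono mult_mono power_mono S pw quarter) (use hpos[of J] \<sigma>0 in auto)
      also have "\<dots> \<le> real n powr (- A) / 2" using asymp by (simp add: mult_ac)
      finally show "real n * (real J * (real (Suc s) * (real n * (2 * real_of_int (h J) + 1)) ^ s) ^ 2 *
        (1 / (\<delta> ^ 2 / 4) * (1 / 4) ^ ((n + 1) div 2 - 1))) \<le> real n powr (- A) / 2" .
    qed
    finally show "measure_pmf.prob (bernoulli_matrix n)
      {N. inverse_op_norm (map_mat real_of_int M + N) \<ge> ennreal (real n powr real d)} \<le> real n powr (- A)"
      by simp
  qed
qed

end
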